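(* Let $d\ge 1$ be an integer and let $p:\mathbb{R}^d\to\mathbb{R}$ be a nontrivial (i.e. not identically zero) polynomial in the real variables $x_1,\dots,x_d$ with real coefficients. Let $\mathcal{Z}_p=\{x\in\mathbb{R}^d: p(x)=0\}$ be its zero set. Then for all real numbers $a<b$, $$\mathcal{H}^{d-1}\big(\mathcal{Z}_p\cap[a,b]^d\big)\;\le\;\Big(\sum_{k=1}^{d}\deg_{x_k}p\Big)\cdot(b-a)^{d-1}.$$
   Context: For $k\in\{1,\dots,d\}$, $\deg_{x_k}p$ denotes the degree of $p$ in the variable $x_k$, i.e. the largest exponent of $x_k$ occurring in a monomial of $p$ with nonzero coefficient (so $\deg_{x_k}p=0$ if $p$ does not depend on $x_k$). $\mathcal{H}^{d-1}$ denotes the $(d-1)$-dimensional Hausdorff measure on $\mathbb{R}^d$ with respect to the Euclidean distance, with the standard normalization of geometric measure theory: on $\mathbb{R}^{d-1}$ (equivalently, on any $(d-1)$-dimensional affine subspace of $\mathbb{R}^d$) it coincides with $(d-1)$-dimensional Lebesgue measure, so that a $(d-1)$-dimensional cube of side length $s$ has measure $s^{d-1}$. In particular, $\mathcal{H}^0$ is the counting measure. For $d=1$, the factor $(b-a)^{d-1}$ equals $1$. *)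

theory Defs
  imports "HOL-Analysis.Analysis" "HOL-Library.Poly_Mapping"
begin

section \<open>Real polynomials in the variables indexed by a finite type\<close>

text \<open>A monomial is a finitely supported exponent vector, and a polynomial is a finitely supported
  map from monomials to their coefficients.\<close>

type_synonym 'n real_mpoly = "('n \<Rightarrow>\<^sub>0 nat) \<Rightarrow>\<^sub>0 real"

definition mpoly_eval :: "'n::finite real_mpoly \<Rightarrow> real ^ 'n \<Rightarrow> real" where
  "mpoly_eval p x =
     (\<Sum>m\<in>Poly_Mapping.keys p. Poly_Mapping.lookup p m * (\<Prod>i\<in>UNIV. (x $ i) ^ Poly_Mapping.lookup m i))"

definition mpoly_degree_in :: "'n real_mpoly \<Rightarrow> 'n \<Rightarrow> nat" where
  "mpoly_degree_in p k = Max (insert 0 ((\<lambda>m. Poly_Mapping.lookup m k) ` Poly_Mapping.keys p))"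

definition zero_set :: "'n::finite real_mpoly \<Rightarrow> (real ^ 'n) set" where
  "zero_set p = {x. mpoly_eval p x = 0}"

section \<open>Hausdorff measure of integer dimension\<close>

text \<open>The factor \<^term>\<open>unit_ball_vol (real s)\<close> with half diameters is the normalization for which
  the \<open>s\<close>-dimensional measure agrees with Lebesgue measure on \<open>s\<close>-dimensional affine subspaces.
  Empty members of a cover contribute nothing; this matters only for \<open>s = 0\<close>, where a nonempty set
  has weight 1 even if its diameter is 0, since \<open>0 ^ 0 = 1\<close>.\<close>

definition hausdorff_weight :: "nat \<Rightarrow> 'a::metric_space set \<Rightarrow> ennreal" where
  "hausdorff_weight s U =
     (if U = {} then 0 else ennreal (unit_ball_vol (real s) * (diameter U / 2) ^ s))"

text \<open>Boundedness is required explicitly because \<^const>\<open>diameter\<close> is meaningful for bounded sets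
  only.\<close>

definition hausdorff_content :: "nat \<Rightarrow> real \<Rightarrow> 'a::metric_space set \<Rightarrow> ennreal" where
  "hausdorff_content s \<delta> A =
     (INF U \<in> {U :: nat \<Rightarrow> 'a set. A \<subseteq> (\<Union>i. U i) \<and> (\<forall>i. bounded (U i) \<and> diameter (U i) \<le> \<delta>)}.
        suminf (\<lambda>i. hausdorff_weight s (U i)))"

text \<open>This is the Hausdorff outer measure, defined on all subsets; the Hausdorff measure is its
  restriction to the measurable sets, which include all Borel sets.\<close>

definition hausdorff_measure :: "nat \<Rightarrow> 'a::metric_space set \<Rightarrow> ennreal" where
  "hausdorff_measure s A = (SUP \<delta> \<in> {0<..}. hausdorff_content s \<delta> A)"

end

(* Idea. Let q be a smooth function whose gradient G does not vanish at z with q z = 0. For small r the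
   zero set of q in the ball cball z r is seen, along the k-th coordinate axis, as a region containing the
   projection of a flat (d-1)-disc of radius almost r, by the intermediate value theorem on short
   segments; its measure is at least about |G_k| / |G| times that of the disc, and the sum over k of
   |G_k| / |G| is at least 1. A Vitali covering argument turns this lower density bound into
     H^(d-1) E <= sum over k of the measure of the k-th projection of E
   for every Borel set E inside a small piece of a regular zero set. Singular
   zeros of p do no harm: every zero of p is a regular zero of some iterated partial derivative q of p, so
   the zero set splits into countably many disjoint Borel pieces of this kind. Almost every line in
   direction k meets at most deg_k p of the pieces, and summing gives the bound.

   To stay inside real ^ 'n, a (d-1)-dimensional projection is replaced by a slab of thickness one over it. *)
theory Submission
  imports Defs
begin

section \<open>Hausdorff measure and lower densities\<close>

text \<open>Only an upper bound for the Hausdorff measure is wanted, so one-sided estimates suffice: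
  nothing is parametrized and no area formula is used. Continuity of \<open>q\<close> and
  differentiability at the single point \<open>z\<close> already give the lower density there. The
  factor |G_k| / |G| is the cosine of the angle between the normal and the k-th axis, and these
  factors add up to at least 1 because the l1 norm dominates the Euclidean norm. For a fixed
  \<open>c < 1\<close> all losses are collected in \<open>c ^ CARD('n)\<close>: d-1 factors from
  shrinking the disc radius from r to c r, one from the variation of the gradient over a piece. The
  pieces depend on \<open>c\<close>, so \<open>c\<close> tends to 1 only in the final inequality.
  The obstacle is measurability: the projection of a Borel set need not be Borel, and the measure of
  projections is additive only where the projection is injective. Each piece therefore carries its
  own set of directions, those in which the gradient component does not vanish on it.\<close>

lemma ennreal_less_add_pos: "x < top \<Longrightarrow> 0 < e \<Longrightarrow> x < x + ennreal e" for x :: ennreal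
  using ennreal_add_left_cancel_less[of x 0 "ennreal e"] by simp

section \<open>Countable subadditivity of Hausdorff content and measure\<close>

lemma hausdorff_content_le_measure: "\<delta> > 0 \<Longrightarrow> hausdorff_content s \<delta> A \<le> hausdorff_measure s A"
  unfolding hausdorff_measure_def by (rule SUP_upper) auto

lemma hausdorff_content_UN_le:
  "hausdorff_content s \<delta> (\<Union>i::nat. A i) \<le> suminf (\<lambda>i. hausdorff_content s \<delta> (A i))"
proof (rule ennreal_le_epsilon)
  fix e :: real
  assume fin: "suminf (\<lambda>i. hausdorff_content s \<delta> (A i)) < top" and e: "e > 0"
  have "\<exists>U. A i \<subseteq> (\<Union>j::nat. U j) \<and> (\<forall>j. bounded (U j) \<and> diameter (U j) \<le> \<delta>) \<and>
      suminf (\<lambda>j. hausdorff_weight s (U j)) < hausdorff_content s \<delta> (A i) + ennreal (e * (1/2) ^ Suc i)" for i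
  proof -
    have "hausdorff_content s \<delta> (A i) < top"
      using fin ennreal_suminf_lessD by blast
    then have "hausdorff_content s \<delta> (A i) < hausdorff_content s \<delta> (A i) + ennreal (e * (1/2) ^ Suc i)"
      using e by (intro ennreal_less_add_pos) auto
    then show ?thesis
      unfolding hausdorff_content_def[of _ _ "A i"] by (subst (asm) INF_less_iff) auto
  qed
  then obtain U where U: "\<And>i. A i \<subseteq> (\<Union>j::nat. U i j)" "\<And>i j. bounded (U i j)" "\<And>i j. diameter (U i j) \<le> \<delta>"
      and Uw: "\<And>i. suminf (\<lambda>j. hausdorff_weight s (U i j)) < hausdorff_content s \<delta> (A i) + ennreal (e * (1/2) ^ Suc i)"
    by metis
  have "hausdorff_content s \<delta> (\<Union>i. A i) \<le> suminf (\<lambda>n. hausdorff_weight s (case_prod U (prod_decode n)))"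
  proof -
    have "(\<Union>i. A i) \<subseteq> (\<Union>n. case_prod U (prod_decode n))"
    proof
      fix x assume "x \<in> (\<Union>i. A i)"
      then obtain i j where "x \<in> U i j" using U(1) by blast
      then have "x \<in> case_prod U (prod_decode (prod_encode (i, j)))" by simp
      then show "x \<in> (\<Union>n. case_prod U (prod_decode n))" by (rule UN_I[OF UNIV_I])
    qed
    then show ?thesis
      unfolding hausdorff_content_def using U(2,3)
      by (intro INF_lower) (auto split: prod.split)
  qed
  also have "\<dots> = suminf (\<lambda>i. suminf (\<lambda>j. hausdorff_weight s (U i j)))"
    by (rule suminf_ennreal_2dimen[where f = "\<lambda>p. hausdorff_weight s (case_prod U p)"]) simp
  also have "\<dots> \<le> suminf (\<lambda>i. hausdorff_content s \<delta> (A i) + ennreal (e * (1/2) ^ Suc i))"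
    using Uw by (intro suminf_le) (auto intro: less_imp_le)
  also have "\<dots> = suminf (\<lambda>i. hausdorff_content s \<delta> (A i)) + suminf (\<lambda>i. ennreal (e * (1/2) ^ Suc i))"
    by (rule suminf_add[symmetric]) auto
  also have "suminf (\<lambda>i. ennreal (e * (1/2) ^ Suc i)) = ennreal e"
    using sums_mult[OF power_half_series, of e] e
    by (subst suminf_ennreal_eq[where x=e]) auto
  finally show "hausdorff_content s \<delta> (\<Union>i. A i) \<le> suminf (\<lambda>i. hausdorff_content s \<delta> (A i)) + ennreal e" .
qed

lemma hausdorff_measure_UN_le:
  "hausdorff_measure s (\<Union>i::nat. A i) \<le> suminf (\<lambda>i. hausdorff_measure s (A i))"
  unfolding hausdorff_measure_def[of s "\<Union>i. A i"]
proof (rule SUP_least)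
  fix \<delta> :: real assume "\<delta> \<in> {0<..}"
  then show "hausdorff_content s \<delta> (\<Union>i. A i) \<le> suminf (\<lambda>i. hausdorff_measure s (A i))"
    by (intro order.trans[OF hausdorff_content_UN_le] suminf_le hausdorff_content_le_measure) auto
qed

lemma hausdorff_content_le_suminf:
  assumes "A \<subseteq> (\<Union>i. U i)" "\<And>i::nat. bounded (U i)" "\<And>i. diameter (U i) \<le> \<delta>"
  shows "hausdorff_content s \<delta> A \<le> suminf (\<lambda>i. hausdorff_weight s (U i))"
  unfolding hausdorff_content_def using assms by (intro INF_lower) auto

lemma hausdorff_weight_cball:
  fixes z :: "'a::euclidean_space"
  assumes "r \<ge> 0"
  shows "hausdorff_weight s (cball z r) = ennreal (unit_ball_vol (real s) * r ^ s)"
  using assms by (simp add: hausdorff_weight_def)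

text \<open>The balls in \<open>U\<close> satisfying the density bound form a fine cover of
  \<open>E\<close>. A disjoint Vitali subfamily has summable weights, because the measures of
  \<open>U\<close> are finite. Enlarging only the balls from index \<open>m\<close> on still covers
  \<open>E\<close>, and the enlarged tail tends to zero as \<open>m\<close> grows, so the factor
  \<open>5 ^ s\<close> costs nothing in the limit.\<close>

lemma hausdorff_content_le_open:
  fixes M :: "'k \<Rightarrow> 'a::euclidean_space measure"
  assumes K: "finite K" "\<And>k. k \<in> K \<Longrightarrow> sets (M k) = sets borel" "\<And>k. k \<in> K \<Longrightarrow> finite_measure (M k)"
    and c: "c > 0" and \<delta>: "\<delta> > 0"
    and U: "open U" "E \<subseteq> U"
    and dens: "\<And>z. z \<in> E \<Longrightarrow> \<forall>\<^sub>F r in at_right 0.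
        ennreal (c * (unit_ball_vol (real s) * r ^ s)) \<le> (\<Sum>k\<in>K. emeasure (M k) (cball z r))"
  shows "ennreal c * hausdorff_content s \<delta> E \<le> (\<Sum>k\<in>K. emeasure (M k) U)"
proof -
  define ub where "ub = unit_ball_vol (real s)"
  have ub: "ub > 0" unfolding ub_def by simp
  \<comment> \<open>The bound \<open>\<delta> / 10\<close> on the radius keeps the diameter
    \<open>10 * r\<close> of a fivefold enlarged ball within \<open>\<delta>\<close>.\<close>
  define I where "I = {(z, r). z \<in> E \<and> 0 < r \<and> r \<le> \<delta> / 10 \<and> cball z r \<subseteq> U \<and>
      ennreal (c * (ub * r ^ s)) \<le> (\<Sum>k\<in>K. emeasure (M k) (cball z r))}"
  have fine: "\<exists>r. (z, r) \<in> I \<and> r < e" if "z \<in> E" "e > 0" for z e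
  proof -
    obtain d where d: "d > 0" "cball z d \<subseteq> U"
      using U \<open>z \<in> E\<close> open_contains_cball by blast
    have "\<forall>\<^sub>F r in at_right 0. r < min d (min e (\<delta> / 10)) \<and> 0 < (r::real)"
      using d(1) \<open>e > 0\<close> \<delta> by (intro eventually_at_rightI[of 0 "min d (min e (\<delta> / 10))"]) auto
    then have "\<forall>\<^sub>F r in at_right 0. (z, r) \<in> I \<and> r < e"
      using dens[OF \<open>z \<in> E\<close>]
    proof eventually_elim
      case (elim r)
      then have "cball z r \<subseteq> U" using d by (meson min_less_iff_conj order.trans less_imp_le subset_cball)
      then show ?case using elim \<open>z \<in> E\<close> by (auto simp: I_def ub_def)
    qed
    then show ?thesis
      using eventually_happens'[of "at_right (0::real)"] by (metis (mono_tags, lifting) trivial_limit_at_right_real)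
  qed
  obtain C where C: "countable C" "C \<subseteq> I"
      "pairwise (\<lambda>i j. disjnt (cball (fst i) (snd i)) (cball (fst j) (snd j))) C"
    and Ccov: "\<And>i. i \<in> I \<Longrightarrow> \<exists>j. j \<in> C \<and> \<not> disjnt (cball (fst i) (snd i)) (cball (fst j) (snd j)) \<and>
                        cball (fst i) (snd i) \<subseteq> ball (fst j) (5 * snd j)"
  proof (rule Vitali_covering_lemma_cballs_balls[where K = I and r = snd and a = fst])
    show "0 < snd i \<and> snd i \<le> \<delta> / 10" if "i \<in> I" for i
      using that by (auto simp: I_def)
  qed blast
  \<comment> \<open>\<open>C\<close> may be finite, so it is enumerated over an index set
    \<open>N\<close>; outside \<open>N\<close> the weights \<open>w\<close> are zero and the sets
    \<open>B\<close> empty.\<close>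
  define N where "N = to_nat_on C ` C"
  define e where "e = from_nat_into C"
  have eC: "e n \<in> C" if "n \<in> N" for n
    using that C(1) by (auto simp: N_def e_def)
  have e_ex: "\<exists>n\<in>N. e n = j" if "j \<in> C" for j
    using that C(1) by (auto simp: N_def e_def)
  have e_inj: "n = m" if "n \<in> N" "m \<in> N" "e n = e m" for n m
    using that C(1) by (auto simp: N_def e_def)
  define a where "a n = fst (e n)" for n
  define r where "r n = snd (e n)" for n
  have rpos: "0 < r n" "10 * r n \<le> \<delta>" "cball (a n) (r n) \<subseteq> U"
    "ennreal (c * (ub * r n ^ s)) \<le> (\<Sum>k\<in>K. emeasure (M k) (cball (a n) (r n)))" if "n \<in> N" for n
  proof -
    have "(a n, r n) \<in> I" using eC[OF that] C(2) by (auto simp: a_def r_def)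
    then show "0 < r n" "10 * r n \<le> \<delta>" "cball (a n) (r n) \<subseteq> U"
      "ennreal (c * (ub * r n ^ s)) \<le> (\<Sum>k\<in>K. emeasure (M k) (cball (a n) (r n)))"
      unfolding I_def by auto
  qed
  define w where "w n = (if n \<in> N then ub * r n ^ s else 0)" for n
  have w0: "w n \<ge> 0" for n using ub rpos(1)[of n] by (auto simp: w_def)
  define B where "B n = (if n \<in> N then cball (a n) (r n) else {})" for n
  have Bdisj: "disjoint_family B"
    unfolding disjoint_family_on_def
  proof (intro ballI impI)
    fix m n :: nat assume "m \<noteq> n"
    then show "B m \<inter> B n = {}"
      using C(3) eC[of m] eC[of n] e_inj[of m n]
      by (auto simp: B_def a_def r_def pairwise_def disjnt_def)
  qed
  have "suminf (\<lambda>n. ennreal (c * w n)) \<le> suminf (\<lambda>n. \<Sum>k\<in>K. emeasure (M k) (B n))"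
    using rpos(4) by (intro suminf_le) (auto simp: w_def B_def)
  also have "\<dots> = (\<Sum>k\<in>K. suminf (\<lambda>n. emeasure (M k) (B n)))"
    by (rule suminf_sum) auto
  also have "\<dots> = (\<Sum>k\<in>K. emeasure (M k) (\<Union>n. B n))"
    using K by (intro sum.cong refl suminf_emeasure Bdisj) (auto simp: B_def)
  also have "\<dots> \<le> (\<Sum>k\<in>K. emeasure (M k) U)"
  proof (intro sum_mono emeasure_mono)
    show "(\<Union>n. B n) \<subseteq> U" using rpos(3) by (auto simp: B_def split: if_splits)
  qed (use U K in auto)
  finally have sumw: "suminf (\<lambda>n. ennreal (c * w n)) \<le> (\<Sum>k\<in>K. emeasure (M k) U)" .
  also have "\<dots> < top"
  proof -
    have "emeasure (M k) U < top" if "k \<in> K" for k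
      using finite_measure.emeasure_finite[OF K(3)[OF that]] by (simp add: less_top)
    then show ?thesis using K(1) by simp
  qed
  finally have "summable (\<lambda>n. c * w n)"
    using c w0 by (intro summable_suminf_not_top) auto
  then have sw: "summable w" using c by (simp add: summable_cmult_iff)
  have bnd: "hausdorff_content s \<delta> E \<le> ennreal (suminf w + 5 ^ s * suminf (\<lambda>n. w (n + m)))" for m
  proof -
    \<comment> \<open>A point outside the first \<open>m\<close> balls has a small ball around it missing them, so it lies in
      the fivefold enlargement of a later ball.\<close>
    define V where "V n = (if n \<in> N then cball (a n) (if n < m then r n else 5 * r n) else {})" for n
    define v where "v n = (if n < m then w n else 5 ^ s * w n)" for n
    have "hausdorff_content s \<delta> E \<le> suminf (\<lambda>n. hausdorff_weight s (V n))"
    proof (rule hausdorff_content_le_suminf)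
      show "E \<subseteq> (\<Union>n. V n)"
      proof
        fix x assume "x \<in> E"
        show "x \<in> (\<Union>n. V n)"
        proof (cases "x \<in> (\<Union>n<m. B n)")
          case True
          then show ?thesis by (auto simp: B_def V_def split: if_splits)
        next
          case False
          moreover have "closed (\<Union>n<m. B n)" by (auto simp: B_def)
          ultimately have "\<exists>d>0. cball x d \<subseteq> - (\<Union>n<m. B n)"
            unfolding closed_def open_contains_cball by blast
          then obtain d where d: "d > 0" "cball x d \<subseteq> - (\<Union>n<m. B n)" by blast
          obtain \<rho> where \<rho>: "(x, \<rho>) \<in> I" "\<rho> < d" using fine[OF \<open>x \<in> E\<close> d(1)] by blast
          obtain j where j: "j \<in> C" "\<not> disjnt (cball x \<rho>) (cball (fst j) (snd j))" "cball x \<rho> \<subseteq> ball (fst j) (5 * snd j)"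
            using Ccov[OF \<rho>(1)] by auto
          obtain n where n: "n \<in> N" "e n = j" using e_ex[OF j(1)] by blast
          have "\<not> n < m"
          proof
            assume "n < m"
            then have "cball (fst j) (snd j) \<subseteq> (\<Union>n<m. B n)"
              using n by (auto simp: B_def a_def r_def)
            moreover have "cball x \<rho> \<subseteq> cball x d" using \<rho>(2) by (intro subset_cball) simp
            ultimately show False using d(2) j(2) unfolding disjnt_def by blast
          qed
          have "x \<in> cball x \<rho>" using \<rho> by (auto simp: I_def)
          then have "x \<in> ball (a n) (5 * r n)" using subsetD[OF j(3)] n(2) by (simp only: a_def r_def)
          then have "x \<in> V n" using \<open>\<not> n < m\<close> n by (simp add: V_def)
          then show ?thesis by blast
        qed
      qed
      show "bounded (V n)" for n by (auto simp: V_def)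
      show "diameter (V n) \<le> \<delta>" for n using rpos(1,2)[of n] \<delta> by (auto simp: V_def)
    qed
    also have "\<dots> = suminf (\<lambda>n. ennreal (v n))"
      using rpos(1) by (intro arg_cong[of _ _ suminf] ext)
        (auto simp: V_def v_def w_def hausdorff_weight_cball less_imp_le ub_def power_mult_distrib algebra_simps
             simp: hausdorff_weight_def dest: order.asym)
    also have "suminf (\<lambda>n. ennreal (v n)) = ennreal ((\<Sum>n<m. v n) + suminf (\<lambda>n. v (n + m)))"
    proof (rule suminf_ennreal_eq)
      show "v n \<ge> 0" for n using w0 by (simp add: v_def)
      show "v sums ((\<Sum>n<m. v n) + suminf (\<lambda>n. v (n + m)))"
      proof -
      have "summable (\<lambda>n. v (n + m))"
        using sw by (auto simp: v_def intro!: summable_mult summable_ignore_initial_segment)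
      then have "summable v" by (simp only: summable_iff_shift)
      from summable_sums[OF this] show ?thesis
        using suminf_split_initial_segment[OF \<open>summable v\<close>, of m] by (simp add: add.commute)
      qed
    qed
    also have "\<dots> \<le> ennreal (suminf w + 5 ^ s * suminf (\<lambda>n. w (n + m)))"
    proof (intro ennreal_leI add_mono)
      show "(\<Sum>n<m. v n) \<le> suminf w"
        using sum_le_suminf[OF sw, of "{..<m}"] w0 by (simp add: v_def)
      show "suminf (\<lambda>n. v (n + m)) \<le> 5 ^ s * suminf (\<lambda>n. w (n + m))"
        using sw by (simp add: v_def suminf_mult summable_ignore_initial_segment)
    qed
    finally show ?thesis .
  qed
  have "(\<lambda>m. suminf w + 5 ^ s * suminf (\<lambda>n. w (n + m))) \<longlonglongrightarrow> suminf w + 5 ^ s * 0"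
    by (intro tendsto_intros suminf_exist_split2 sw)
  then have "(\<lambda>m. ennreal (suminf w + 5 ^ s * suminf (\<lambda>n. w (n + m)))) \<longlonglongrightarrow> ennreal (suminf w)"
    by (intro tendsto_ennrealI) simp
  then have "hausdorff_content s \<delta> E \<le> ennreal (suminf w)"
    by (rule LIMSEQ_le_const) (use bnd in auto)
  then have "ennreal c * hausdorff_content s \<delta> E \<le> ennreal c * ennreal (suminf w)"
    by (rule mult_left_mono) auto
  also have "\<dots> = suminf (\<lambda>n. ennreal (c * w n))"
    using c w0 sw by (subst suminf_ennreal2) (auto simp: suminf_mult ennreal_mult suminf_nonneg intro: summable_mult)
  finally show ?thesis using sumw by simp
qed

text \<open>Outer regularity shrinks the open set of the previous bound to \<open>E\<close>, up to
  \<open>\<epsilon>\<close>. As \<open>K\<close> is finite, the intersection of the open sets chosen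
  for the single measures serves all of them at once.\<close>

lemma hausdorff_measure_le_density:
  fixes M :: "'k \<Rightarrow> 'a::euclidean_space measure"
  assumes K: "finite K" "\<And>k. k \<in> K \<Longrightarrow> sets (M k) = sets borel" "\<And>k. k \<in> K \<Longrightarrow> finite_measure (M k)"
    and c: "c > 0" and E: "E \<in> sets borel"
    and dens: "\<And>z. z \<in> E \<Longrightarrow> \<forall>\<^sub>F r in at_right 0.
        ennreal (c * (unit_ball_vol (real s) * r ^ s)) \<le> (\<Sum>k\<in>K. emeasure (M k) (cball z r))"
  shows "ennreal c * hausdorff_measure s E \<le> (\<Sum>k\<in>K. emeasure (M k) E)"
proof -
  have "ennreal c * hausdorff_content s \<delta> E \<le> (\<Sum>k\<in>K. emeasure (M k) E)" if \<delta>: "\<delta> > 0" for \<delta>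
  proof (rule ennreal_le_epsilon)
    fix \<epsilon> :: real assume \<epsilon>: "\<epsilon> > 0"
    have "\<exists>U. open U \<and> E \<subseteq> U \<and> emeasure (M k) U \<le> emeasure (M k) E + ennreal (\<epsilon> / (card K + 1))" if "k \<in> K" for k
    proof -
      interpret finite_measure "M k" using K that by auto
      have "emeasure (M k) E < emeasure (M k) E + ennreal (\<epsilon> / (card K + 1))"
        using \<epsilon> by (intro ennreal_less_add_pos) (auto simp: less_top[symmetric])
      then show ?thesis
        using outer_regular[OF K(2)[OF that] _ E] emeasure_finite
        by (auto simp: INF_less_iff intro: less_imp_le)
    qed
    then obtain U where U: "\<And>k. k \<in> K \<Longrightarrow> open (U k)" "\<And>k. k \<in> K \<Longrightarrow> E \<subseteq> U k"
      "\<And>k. k \<in> K \<Longrightarrow> emeasure (M k) (U k) \<le> emeasure (M k) E + ennreal (\<epsilon> / (card K + 1))" by metis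
    have "ennreal c * hausdorff_content s \<delta> E \<le> (\<Sum>k\<in>K. emeasure (M k) (\<Inter>k\<in>K. U k))"
      using U K(1) by (intro hausdorff_content_le_open[OF K c \<delta> _ _ dens]) auto
    also have "\<dots> \<le> (\<Sum>k\<in>K. emeasure (M k) (U k))"
      using U K by (intro sum_mono emeasure_mono) auto
    also have "\<dots> \<le> (\<Sum>k\<in>K. emeasure (M k) E + ennreal (\<epsilon> / (card K + 1)))"
      by (intro sum_mono U)
    also have "\<dots> = (\<Sum>k\<in>K. emeasure (M k) E) + ennreal (card K * (\<epsilon> / (card K + 1)))"
      using \<epsilon> by (simp add: sum.distrib ennreal_of_nat_eq_real_of_nat flip: ennreal_mult)
    also have "\<dots> \<le> (\<Sum>k\<in>K. emeasure (M k) E) + ennreal \<epsilon>"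
      using \<epsilon> by (intro add_left_mono ennreal_leI) (simp add: field_simps)
    finally show "ennreal c * hausdorff_content s \<delta> E \<le> (\<Sum>k\<in>K. emeasure (M k) E) + ennreal \<epsilon>" .
  qed
  then show ?thesis
    unfolding hausdorff_measure_def by (subst SUP_mult_left_ennreal) (auto intro!: SUP_least)
qed

section \<open>Projections along a coordinate axis\<close>

definition flat :: "'n::finite \<Rightarrow> real ^ 'n \<Rightarrow> real ^ 'n" where
  "flat k x = x - x $ k *\<^sub>R axis k 1"

text \<open>The part over the unit slab of the cylinder spanned by \<open>A\<close> in direction \<open>k\<close>: its Lebesgue
  measure is the \<open>(d - 1)\<close>-dimensional measure of the projection of \<open>A\<close> along the \<open>k\<close>-th axis.\<close>

definition shadow :: "'n::finite \<Rightarrow> (real ^ 'n) set \<Rightarrow> (real ^ 'n) set" where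
  "shadow k A = {x. x $ k \<in> {0..1} \<and> (\<exists>t. x + t *\<^sub>R axis k 1 \<in> A)}"

lemma flat_nth: "flat k x $ i = (if i = k then 0 else x $ i)"
  by (simp add: flat_def axis_def)

lemma linear_flat: "linear (flat k)"
  by (rule linearI) (simp_all add: flat_def algebra_simps)

lemma continuous_on_flat [continuous_intros]: "continuous_on S f \<Longrightarrow> continuous_on S (\<lambda>x. flat k (f x))"
  unfolding flat_def by (intro continuous_intros)

lemma flat_add_axis [simp]: "flat k (x + t *\<^sub>R axis k 1) = flat k x"
  by (simp add: vec_eq_iff flat_nth axis_def)

lemma flat_eqD: "flat k x = flat k y \<Longrightarrow> y = x + (y $ k - x $ k) *\<^sub>R axis k 1"
  by (simp add: flat_def algebra_simps)

lemma shadow_eq: "shadow k A = {x. x $ k \<in> {0..1} \<and> flat k x \<in> flat k ` A}"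
proof -
  have "(\<exists>t. x + t *\<^sub>R axis k 1 \<in> A) \<longleftrightarrow> flat k x \<in> flat k ` A" for x
  proof
    assume "flat k x \<in> flat k ` A"
    then obtain y where "y \<in> A" "flat k x = flat k y" by auto
    then show "\<exists>t. x + t *\<^sub>R axis k 1 \<in> A" using flat_eqD by metis
  next
    assume "\<exists>t. x + t *\<^sub>R axis k 1 \<in> A"
    then show "flat k x \<in> flat k ` A" by (metis flat_add_axis image_eqI)
  qed
  then show ?thesis by (simp add: shadow_def)
qed

lemma shadow_mono: "A \<subseteq> B \<Longrightarrow> shadow k A \<subseteq> shadow k B"
  by (auto simp: shadow_def)

text \<open>The source of all measurability of shadows: continuous images of compact sets are
  compact.\<close>

lemma compact_shadow:
  assumes "compact A"
  shows "compact (shadow k A)"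
proof -
  have cA: "compact (flat k ` A)"
    by (intro compact_continuous_image continuous_intros assms)
  have "closed (shadow k A)"
  proof -
    have "closed ((\<lambda>x. x $ k) -` {0..1::real} \<inter> flat k -` (flat k ` A))"
      by (intro closed_Int continuous_closed_vimage compact_imp_closed[OF cA])
        (auto simp: linear_continuous_at linear_flat linear_conv_bounded_linear[THEN iffD1])
    moreover have "shadow k A = (\<lambda>x. x $ k) -` {0..1::real} \<inter> flat k -` (flat k ` A)"
      by (auto simp: shadow_eq)
    ultimately show ?thesis by simp
  qed
  moreover have "bounded (shadow k A)"
  proof -
    obtain B where B: "\<And>y. y \<in> flat k ` A \<Longrightarrow> norm y \<le> B"
      using compact_imp_bounded[OF cA] by (auto simp: bounded_iff)
    have "norm x \<le> B + 1" if "x \<in> shadow k A" for x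
    proof -
      have "x = flat k x + x $ k *\<^sub>R axis k 1" by (simp add: flat_def)
      then have "norm x \<le> norm (flat k x) + norm (x $ k *\<^sub>R axis k (1::real))"
        by (metis norm_triangle_ineq)
      also have "\<dots> \<le> B + 1"
        using that B by (intro add_mono) (auto simp: shadow_eq)
      finally show ?thesis .
    qed
    then show ?thesis by (auto simp: bounded_iff)
  qed
  ultimately show ?thesis by (simp add: compact_eq_bounded_closed)
qed

lemma prod_Basis_cart: "(\<Prod>b\<in>(Basis :: (real ^ 'n) set). f b) = (\<Prod>i\<in>UNIV. f (axis i 1))"
proof -
  have "(Basis :: (real ^ 'n) set) = (\<lambda>i. axis i 1) ` UNIV"
    by (auto simp: Basis_vec_def)
  moreover have "inj (\<lambda>i::'n. axis i (1::real))"
    by (auto simp: inj_def axis_eq_axis)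
  ultimately show ?thesis
    using prod.reindex[of "\<lambda>i::'n. axis i (1::real)" UNIV f] by (simp only: o_def)
qed

text \<open>Fubini in the standard coordinates: the one along \<open>axis k 1\<close> contributes
  the length 1 of the slab, the others the volume of a ball of dimension
  \<open>CARD('n) - 1\<close>.\<close>

lemma emeasure_cylinder:
  fixes k :: "'n::finite"
  assumes "\<rho> > 0"
  shows "emeasure lborel {x. x $ k \<in> {0..1} \<and> norm (flat k x) \<le> \<rho>} =
    ennreal (unit_ball_vol (real (CARD('n) - 1)) * \<rho> ^ (CARD('n) - 1))"
proof -
  define e :: "real ^ 'n" where "e = axis k 1"
  define A where "A = Basis - {e}"
  have e: "e \<in> Basis" by (simp add: e_def)
  have BA: "Basis = insert e A" "e \<notin> A" "finite A" using e by (auto simp: A_def)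
  have cA: "card A = CARD('n) - 1"
    using e by (simp add: A_def card_Diff_singleton)
  interpret product_sigma_finite "\<lambda>_::real ^ 'n. lborel :: real measure" by standard
  let ?g = "\<lambda>f. \<Sum>b\<in>Basis. f b *\<^sub>R b :: real ^ 'n"
  have nk: "x $ k = x \<bullet> e" for x :: "real ^ 'n"
    by (simp add: e_def inner_axis)
  have nf: "norm (flat k (?g f)) = sqrt (\<Sum>b\<in>A. (f b)\<^sup>2)" for f
  proof -
    have "flat k (?g f) = ?g f - f e *\<^sub>R e"
      using e by (simp add: flat_def nk flip: e_def)
    also have "\<dots> = (\<Sum>b\<in>A. f b *\<^sub>R b)"
      unfolding BA(1) using BA(2,3) by (subst sum.insert) auto
    finally have "norm (flat k (?g f)) = sqrt ((\<Sum>b\<in>A. f b *\<^sub>R b) \<bullet> (\<Sum>b\<in>A. f b *\<^sub>R b))"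
      by (simp add: norm_eq_sqrt_inner)
    also have "(\<Sum>b\<in>A. f b *\<^sub>R b) \<bullet> (\<Sum>b\<in>A. f b *\<^sub>R b) = (\<Sum>b\<in>A. (f b)\<^sup>2)"
      using BA by (auto simp: inner_sum_left inner_sum_right inner_Basis A_def power2_eq_square
          if_distrib cong: if_cong intro!: sum.cong)
    finally show ?thesis .
  qed
  define C where "C = {x. x $ k \<in> {0..1} \<and> norm (flat k x) \<le> \<rho>}"
  have "closed C"
  proof -
    have "C = {x. 0 \<le> x $ k} \<inter> {x. x $ k \<le> 1} \<inter> {x. norm (flat k x) \<le> \<rho>}" by (auto simp: C_def)
    then show ?thesis
      by (simp only:) (intro closed_Int closed_Collect_le continuous_intros)
  qed
  then have C [measurable]: "C \<in> sets borel" by simp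
  define D where "D = {f. sqrt (\<Sum>b\<in>A. (f b)\<^sup>2) \<le> \<rho>}"
  let ?P = "\<lambda>I. Pi\<^sub>M I (\<lambda>_. lborel :: real measure)"
  have g: "?g \<in> borel_measurable (?P Basis)" by measurable
  have fe: "(\<lambda>f. f e) \<in> borel_measurable (?P (insert e A))"
    using measurable_component_singleton[of e "insert e A" "\<lambda>_. lborel :: real measure"] by simp
  have fA: "(\<lambda>f. sqrt (\<Sum>b\<in>A. (f b)\<^sup>2)) \<in> borel_measurable (?P J)" if "A \<subseteq> J" for J
    using that measurable_component_singleton[of _ J "\<lambda>_. lborel :: real measure"]
    by (intro measurable_compose[OF _ borel_measurable_sqrt] borel_measurable_sum borel_measurable_power) auto
  have D: "(\<lambda>f. indicator D f :: ennreal) \<in> borel_measurable (?P J)" if "A \<subseteq> J" for J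
  proof -
    have "(\<lambda>f. indicator D f :: ennreal) = (\<lambda>f. indicator {..\<rho>} (sqrt (\<Sum>b\<in>A. (f b)\<^sup>2)))"
      by (auto simp: D_def split: split_indicator)
    then show ?thesis using fA[OF that] by simp
  qed
  have gC: "indicator C (?g f) = (indicator {0..1} (f e) * indicator D f :: ennreal)" for f
  proof -
    have "?g f $ k = f e"
      using e by (simp add: nk)
    then show ?thesis
      using nf[of f] by (auto simp: C_def D_def split: split_indicator)
  qed
  have "emeasure lborel C = (\<integral>\<^sup>+x. indicator C x \<partial>lborel)"
    using C by simp
  also have "\<dots> = (\<integral>\<^sup>+f. indicator C (?g f) \<partial>?P Basis)"
    using g C by (subst lborel_eq, subst nn_integral_distr) auto
  also have "\<dots> = (\<integral>\<^sup>+f. indicator {0..1} (f e) * indicator D f \<partial>?P (insert e A))"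
    by (simp only: gC BA(1)[symmetric])
  also have "\<dots> = (\<integral>\<^sup>+y. \<integral>\<^sup>+f. indicator {0..1::real} y * indicator D f \<partial>?P A \<partial>lborel)"
  proof (subst product_nn_integral_insert_rev)
    show "(\<lambda>f. indicator {0..1} (f e) * indicator D f :: ennreal) \<in> borel_measurable (?P (insert e A))"
      using fe D[of "insert e A"] by (intro borel_measurable_times_ennreal measurable_compose[OF fe]) auto
    have "indicator D (f(e := y)) = (indicator D f :: ennreal)" for f y
    proof -
      have "(\<Sum>b\<in>A. ((f(e := y)) b)\<^sup>2) = (\<Sum>b\<in>A. (f b)\<^sup>2)"
        using BA(2) by (intro sum.cong) auto
      then show ?thesis by (simp add: D_def indicator_def)
    qed
    then show "(\<integral>\<^sup>+y. \<integral>\<^sup>+f. indicator {0..1} ((f(e := y)) e) * indicator D (f(e := y)) \<partial>?P A \<partial>lborel) =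
        (\<integral>\<^sup>+y. \<integral>\<^sup>+f. indicator {0..1::real} y * indicator D f \<partial>?P A \<partial>lborel)"
      by simp
  qed (use BA in auto)
  also have "\<dots> = (\<integral>\<^sup>+y. indicator {0..1::real} y * (\<integral>\<^sup>+f. indicator D f \<partial>?P A) \<partial>lborel)"
    using D[of A] by (intro nn_integral_cong nn_integral_cmult) auto
  also have "\<dots> = (\<integral>\<^sup>+f. indicator D f \<partial>?P A)"
    by (subst nn_integral_multc) auto
  also have "\<dots> = emeasure (?P A) (D \<inter> space (?P A))"
  proof -
    have "D \<inter> space (?P A) \<in> sets (?P A)"
    proof -
      have "D \<inter> space (?P A) = (\<lambda>f. sqrt (\<Sum>b\<in>A. (f b)\<^sup>2)) -` {..\<rho>} \<inter> space (?P A)" by (auto simp: D_def)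
      then show ?thesis using measurable_sets[OF fA[of A], of "{..\<rho>}"] by simp
    qed
    moreover have "(\<integral>\<^sup>+f. indicator D f \<partial>?P A) = (\<integral>\<^sup>+f. indicator (D \<inter> space (?P A)) f \<partial>?P A)"
      by (intro nn_integral_cong) (auto split: split_indicator)
    ultimately show ?thesis by (simp only: nn_integral_indicator)
  qed
  also have "\<dots> = ennreal (unit_ball_vol (real (CARD('n) - 1)) * \<rho> ^ (CARD('n) - 1))"
    unfolding D_def using assms BA by (subst emeasure_cball_aux) (simp_all add: cA)
  finally show ?thesis by (simp only: C_def)
qed

text \<open>The library computes the measure of linear images only for index types of class
  \<^class>\<open>wellorder\<close>, hence this well-ordered copy of a finite type.\<close>

typedef 'a wo = "UNIV :: 'a set" morphisms of_wo to_wo ..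

lemma bij_of_wo: "bij of_wo"
  by (metis bijI' of_wo_inject of_wo_cases UNIV_I)

instance wo :: (finite) finite
proof
  show "finite (UNIV :: 'a wo set)"
    using bij_of_wo by (metis bij_betw_finite finite_class.finite_UNIV)
qed

instantiation wo :: (finite) wellorder
begin

definition "x \<le> y \<longleftrightarrow> to_nat (of_wo x) \<le> to_nat (of_wo y)"
definition "x < y \<longleftrightarrow> to_nat (of_wo x) < to_nat (of_wo y)"

instance
proof
  fix P :: "'a wo \<Rightarrow> bool" and a
  assume "\<And>x. (\<And>y. y < x \<Longrightarrow> P y) \<Longrightarrow> P x"
  then show "P a"
    by (rule measure_induct_rule[of "\<lambda>x. to_nat (of_wo x)" P]) (simp add: less_wo_def)
qed (auto simp: less_eq_wo_def less_wo_def of_wo_inject)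

end

lemma CARD_wo: "CARD('a wo) = CARD('a)"
  using bij_betw_same_card[OF bij_of_wo] .

definition vec_wo :: "real ^ 'n \<Rightarrow> real ^ ('n::finite) wo" where
  "vec_wo x = (\<chi> j. x $ of_wo j)"

lemma sum_of_wo: "(\<Sum>j\<in>UNIV. f (of_wo j)) = (\<Sum>i\<in>UNIV. f i)"
  using sum.reindex_bij_betw[OF bij_of_wo] .

lemma prod_of_wo: "(\<Prod>j\<in>UNIV. f (of_wo j)) = (\<Prod>i\<in>UNIV. f i)"
  using prod.reindex_bij_betw[OF bij_of_wo] .

lemma inner_vec_wo: "vec_wo x \<bullet> vec_wo y = x \<bullet> y"
  using sum_of_wo[of "\<lambda>i. x $ i * y $ i"] by (simp add: vec_wo_def inner_vec_def)

lemma norm_vec_wo: "norm (vec_wo x) = norm x"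
  by (simp add: norm_eq_sqrt_inner inner_vec_wo)

lemma linear_vec_wo: "linear vec_wo"
  by (rule linearI) (simp_all add: vec_wo_def vec_eq_iff)

lemma vec_wo_axis: "vec_wo (axis k c) = axis (to_wo k) c"
  by (auto simp: vec_wo_def axis_def vec_eq_iff of_wo_inverse to_wo_inverse)

lemma distr_vec_wo: "distr lborel borel (vec_wo :: real ^ 'n::finite \<Rightarrow> _) = lborel"
proof (rule lborel_eqI[symmetric])
  have [measurable]: "(vec_wo :: real ^ 'n \<Rightarrow> _) \<in> borel_measurable borel"
    by (intro borel_measurable_continuous_onI linear_continuous_on linear_conv_bounded_linear[THEN iffD1] linear_vec_wo)
  fix l u :: "real ^ 'n wo"
  assume lu: "\<And>b. b \<in> Basis \<Longrightarrow> l \<bullet> b \<le> u \<bullet> b"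
  define l' u' :: "real ^ 'n" where "l' = (\<chi> i. l $ to_wo i)" and "u' = (\<chi> i. u $ to_wo i)"
  have le: "l $ j \<le> u $ j" for j using lu[of "axis j 1"] by (simp add: inner_axis)
  have "vec_wo -` box l u = box l' u'"
    unfolding l'_def u'_def
    by (auto simp: mem_box_cart vec_wo_def of_wo_inverse to_wo_inverse) (metis of_wo_inverse to_wo_inverse UNIV_I)+
  then have "emeasure (distr lborel borel vec_wo) (box l u) = emeasure lborel (box l' u')"
    by (simp add: emeasure_distr)
  also have "\<dots> = ennreal (\<Prod>b\<in>Basis. (u' - l') \<bullet> b)"
    using le by (intro emeasure_lborel_box) (auto simp: Basis_vec_def inner_axis l'_def u'_def)
  also have "(\<Prod>b\<in>Basis. (u' - l') \<bullet> b) = (\<Prod>j\<in>UNIV. u' $ of_wo j - l' $ of_wo j)"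
    by (simp add: prod_Basis_cart inner_axis prod_of_wo[of "\<lambda>i. u' $ i - l' $ i"])
  also have "\<dots> = (\<Prod>b\<in>Basis. (u - l) \<bullet> b)"
    by (simp add: prod_Basis_cart inner_axis l'_def u'_def of_wo_inverse)
  finally show "emeasure (distr lborel borel vec_wo) (box l u) = ennreal (\<Prod>b\<in>Basis. (u - l) \<bullet> b)" .
qed simp

section \<open>Projected area of a tilted disc\<close>

definition disc :: "real ^ 'n \<Rightarrow> real \<Rightarrow> (real ^ 'n::finite) set" where
  "disc \<nu> \<rho> = {v. \<nu> \<bullet> v = 0 \<and> norm v \<le> \<rho>}"

lemma compact_disc: "compact (disc \<nu> \<rho>)"
proof -
  have "disc \<nu> \<rho> = {v. \<nu> \<bullet> v = 0} \<inter> cball 0 \<rho>" by (auto simp: disc_def)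
  then show ?thesis by (simp add: closed_Int_compact closed_hyperplane)
qed

text \<open>Projecting along an axis scales the area of a disc by the cosine of the angle between
  its normal and the axis. Since a lower bound is enough, it suffices to place a linear image of the
  upright cylinder \<open>C\<close> inside the shadow and to compute a determinant.\<close>

lemma emeasure_shadow_disc_wellorder:
  fixes \<nu> :: "real ^ 'n::{finite, wellorder}"
  assumes \<nu>: "norm \<nu> = 1" and \<rho>: "\<rho> > 0"
  shows "ennreal (\<bar>\<nu> $ k\<bar> * (unit_ball_vol (real (CARD('n) - 1)) * \<rho> ^ (CARD('n) - 1)))
    \<le> emeasure lborel (shadow k (disc \<nu> \<rho>))"
proof -
  define e :: "real ^ 'n::_" where "e = axis k 1"
  define C where "C = {x. x $ k \<in> {0..1} \<and> norm (flat k x) \<le> \<rho>}"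
  obtain R where R: "orthogonal_transformation R" "R e = \<nu>"
    using orthogonal_transformation_exists[of e \<nu>] \<nu> by (auto simp: e_def)
  then have lR: "linear R" by (simp add: orthogonal_transformation_linear)
  have dR: "\<bar>det (matrix R)\<bar> = 1" using R(1) by (simp add: orthogonal_transformation_det)
  have inR: "R x \<bullet> R y = x \<bullet> y" for x y using R(1) by (simp add: orthogonal_transformation_def)
  have eC: "emeasure lborel C = ennreal (unit_ball_vol (real (CARD('n) - 1)) * \<rho> ^ (CARD('n) - 1))"
    unfolding C_def by (rule emeasure_cylinder[OF \<rho>])
  have "C = shadow k (disc e \<rho>)"
  proof -
    have "(\<exists>t. x + t *\<^sub>R e \<in> disc e \<rho>) \<longleftrightarrow> norm (flat k x) \<le> \<rho>" for x
    proof -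
      have "x + t *\<^sub>R e \<in> disc e \<rho> \<longleftrightarrow> t = - x $ k \<and> norm (flat k x) \<le> \<rho>" for t
        by (cases "t = - x $ k") (auto simp: disc_def e_def inner_add_right inner_axis' flat_def)
      then show ?thesis by auto
    qed
    then show ?thesis by (simp add: C_def shadow_def e_def)
  qed
  then have cC: "compact C" by (simp add: compact_shadow compact_disc)
  then have lC: "C \<in> lmeasurable" by (rule lmeasurable_compact)
  have mC: "measure lebesgue C = unit_ball_vol (real (CARD('n) - 1)) * \<rho> ^ (CARD('n) - 1)"
    using eC \<rho> cC by (simp add: measure_def borel_compact)
  define T where "T y = R (flat k y) + (y $ k - R (flat k y) $ k) *\<^sub>R e" for y
  define N where "N y = R y + (y $ k - R y $ k) *\<^sub>R e" for y
  define L where "L x = x + x $ k *\<^sub>R flat k \<nu>" for x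
  have lin: "linear T" "linear N" "linear L"
    unfolding T_def N_def L_def
    by (auto intro!: linearI simp: linear_add[OF linear_flat] linear_add[OF lR] linear_scale[OF linear_flat]
        linear_scale[OF lR] algebra_simps)
  \<comment> \<open>\<open>T\<close> maps the cylinder over the disc orthogonal to \<open>e\<close> into the shadow; it differs by the
    shear \<open>L\<close> from \<open>N\<close>, whose determinant Cramer's rule gives.\<close>
  have NLT: "N y = L (T y)" for y
  proof -
    have "R y = R (flat k y) + y $ k *\<^sub>R \<nu>"
      using R(2) by (simp add: flat_def linear_diff[OF lR] linear_scale[OF lR] flip: e_def)
    then show ?thesis
      by (simp add: N_def L_def T_def e_def flat_def algebra_simps)
  qed
  have dL: "det (matrix L) = 1"
  proof -
    \<comment> \<open>Column \<open>k\<close> of the identity is replaced by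
      \<open>e + flat k \<nu>\<close>, whose \<open>k\<close>-th entry is 1.\<close>
    have "matrix L = (\<chi> i j. if j = k then (mat 1 *v (e + flat k \<nu>)) $ i else mat 1 $ i $ j)"
      unfolding matrix_vector_mul_lid by (auto simp: matrix_def L_def vec_eq_iff e_def axis_def mat_def)
    also have "det \<dots> = (e + flat k \<nu>) $ k * det (mat 1 :: real ^ 'n::_ ^ 'n::_)"
      by (rule cramer_lemma)
    finally show ?thesis by (simp add: flat_nth e_def)
  qed
  have dN: "\<bar>det (matrix N)\<bar> = \<bar>\<nu> $ k\<bar>"
  proof -
    \<comment> \<open>\<open>N\<close> changes only the \<open>k\<close>-th row of \<open>R\<close>,
      into the unit row of coordinate \<open>k\<close>. Since \<open>R\<close> is orthogonal and
      \<open>R e = \<nu>\<close>, that row is the combination of the rows of \<open>R\<close> with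
      coefficients \<open>\<nu> $ i\<close>.\<close>
    have "matrix N = (\<chi> i. if i = k then (\<Sum>i\<in>UNIV. \<nu> $ i *s row i (matrix R)) else row i (matrix R))"
    proof -
      have "(\<Sum>i\<in>UNIV. \<nu> $ i * R (axis j 1) $ i) = (if j = k then 1 else 0)" for j
      proof -
        have "(\<Sum>i\<in>UNIV. \<nu> $ i * R (axis j 1) $ i) = R e \<bullet> R (axis j 1)"
          by (simp add: R(2) inner_vec_def)
        also have "\<dots> = (if j = k then 1 else 0)"
          by (simp add: inR e_def inner_axis_axis)
        finally show ?thesis .
      qed
      then show ?thesis
        by (auto simp: matrix_def N_def vec_eq_iff e_def row_def axis_def)
    qed
    also have "det \<dots> = \<nu> $ k * det (matrix R)"
      by (rule cramer_lemma_transpose)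
    finally show ?thesis using dR by (simp add: abs_mult)
  qed
  have TC: "T ` C \<in> lmeasurable"
    by (rule measurable_linear_image[OF lin(1) lC])
  have "\<bar>\<nu> $ k\<bar> * measure lebesgue C = measure lebesgue (N ` C)"
    by (simp add: measure_linear_image[OF lin(2) lC] dN)
  also have "N ` C = L ` (T ` C)" by (simp add: NLT image_image)
  also have "measure lebesgue \<dots> = measure lebesgue (T ` C)"
    by (simp add: measure_linear_image[OF lin(3) TC] dL)
  finally have "ennreal (\<bar>\<nu> $ k\<bar> * measure lebesgue C) = emeasure lebesgue (T ` C)"
    using TC by (simp add: emeasure_eq_measure2)
  also have "\<dots> \<le> emeasure lebesgue (shadow k (disc \<nu> \<rho>))"
  proof (rule emeasure_mono)
    show "T ` C \<subseteq> shadow k (disc \<nu> \<rho>)"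
    proof (clarsimp simp: shadow_def)
      fix y assume y: "y \<in> C"
      have "T y + (R (flat k y) $ k - y $ k) *\<^sub>R axis k 1 = R (flat k y)"
        by (simp add: T_def e_def algebra_simps)
      moreover have "R (flat k y) \<in> disc \<nu> \<rho>"
        using y inR[of e "flat k y"] R by (simp add: disc_def C_def e_def inner_axis' flat_nth orthogonal_transformation_norm)
      moreover have "T y $ k = y $ k" by (simp add: T_def e_def)
      ultimately show "0 \<le> T y $ k \<and> T y $ k \<le> 1 \<and> (\<exists>t. T y + t *\<^sub>R axis k 1 \<in> disc \<nu> \<rho>)"
        using y by (metis (mono_tags, lifting) C_def atLeastAtMost_iff mem_Collect_eq)
    qed
    show "shadow k (disc \<nu> \<rho>) \<in> sets lebesgue"
      using lmeasurable_compact[OF compact_shadow[OF compact_disc]] by blast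
  qed
  also have "\<dots> = emeasure lborel (shadow k (disc \<nu> \<rho>))"
    by (simp add: borel_compact compact_shadow compact_disc)
  finally show ?thesis by (simp add: mC)
qed

lemma vec_wo_add_axis: "vec_wo (x + t *\<^sub>R axis k 1) = vec_wo x + t *\<^sub>R axis (to_wo k) 1"
  by (simp add: linear_add[OF linear_vec_wo] linear_scale[OF linear_vec_wo] vec_wo_axis)

lemma emeasure_shadow_disc:
  fixes \<nu> :: "real ^ 'n::finite"
  assumes \<nu>: "norm \<nu> = 1" and \<rho>: "\<rho> > 0"
  shows "ennreal (\<bar>\<nu> $ k\<bar> * (unit_ball_vol (real (CARD('n) - 1)) * \<rho> ^ (CARD('n) - 1)))
    \<le> emeasure lborel (shadow k (disc \<nu> \<rho>))"
proof -
  have nth: "vec_wo x $ to_wo k = x $ k" for x :: "real ^ 'n"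
    by (simp add: vec_wo_def to_wo_inverse)
  let ?S = "shadow (to_wo k) (disc (vec_wo \<nu>) \<rho>)"
  have "ennreal (\<bar>\<nu> $ k\<bar> * (unit_ball_vol (real (CARD('n) - 1)) * \<rho> ^ (CARD('n) - 1))) \<le> emeasure lborel ?S"
    using emeasure_shadow_disc_wellorder[of "vec_wo \<nu>" \<rho> "to_wo k"] assms by (simp add: norm_vec_wo CARD_wo nth)
  also have "\<dots> = emeasure (distr lborel borel vec_wo) ?S"
    by (simp add: distr_vec_wo)
  also have "\<dots> = emeasure lborel (vec_wo -` ?S)"
    using compact_shadow[OF compact_disc, of "to_wo k" "vec_wo \<nu>" \<rho>]
    by (subst emeasure_distr) (auto simp: borel_compact linear_conv_bounded_linear[THEN iffD1] linear_vec_wo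
        intro!: borel_measurable_continuous_onI linear_continuous_on)
  also have "vec_wo -` ?S = shadow k (disc \<nu> \<rho>)"
    by (auto simp: shadow_def disc_def nth norm_vec_wo inner_vec_wo simp flip: vec_wo_add_axis)
  finally show ?thesis .
qed

section \<open>Sets meeting each line at most once\<close>

text \<open>Push-forward of Lebesgue measure from the shadow onto \<open>X\<close>, each point of
  the slab being lifted to the point of \<open>X\<close> on its line. For injective
  \<open>flat k\<close> this presents the volume of shadows as a genuine measure, as the density
  comparison requires.\<close>

definition shadow_measure :: "'n::finite \<Rightarrow> (real ^ 'n) set \<Rightarrow> (real ^ 'n) measure" where
  "shadow_measure k X =
     distr (restrict_space lborel (shadow k X)) borel (\<lambda>x. inv_into X (flat k) (flat k x))"

text \<open>On a compact set an injective continuous map has a continuous inverse, so the shadow of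
  a Borel part of \<open>X\<close> is the preimage of that part under a Borel map.\<close>

lemma shadow_measure:
  fixes X :: "(real ^ 'n::finite) set"
  assumes X: "compact X" "inj_on (flat k) X"
  shows sets_shadow_measure: "sets (shadow_measure k X) = sets borel"
    and finite_shadow_measure: "finite_measure (shadow_measure k X)"
    and shadow_borel: "\<And>A. A \<in> sets borel \<Longrightarrow> shadow k (A \<inter> X) \<in> sets borel"
    and emeasure_shadow_measure:
      "\<And>A. A \<in> sets borel \<Longrightarrow> emeasure (shadow_measure k X) A = emeasure lborel (shadow k (A \<inter> X))"
proof -
  let ?h = "\<lambda>x. inv_into X (flat k) (flat k x)"
  have cS: "compact (shadow k X)" by (rule compact_shadow[OF X(1)])
  then have S: "shadow k X \<in> sets borel" by (rule borel_compact)
  have "continuous_on (flat k ` X) (inv_into X (flat k))"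
    using X by (intro continuous_on_inv) (auto intro!: continuous_intros)
  then have "continuous_on (shadow k X) ?h"
    by (rule continuous_on_compose2) (auto simp: shadow_eq intro!: continuous_intros)
  then have h: "?h \<in> borel_measurable (restrict_space borel (shadow k X))"
    by (rule borel_measurable_continuous_on_restrict)
  then have h': "?h \<in> borel_measurable (restrict_space lborel (shadow k X))"
    by (simp add: measurable_def space_restrict_space sets_restrict_space)
  have pre: "?h -` A \<inter> shadow k X = shadow k (A \<inter> X)" for A
    using X(2) by (auto simp: shadow_eq inj_on_image_mem_iff inv_into_into)
  show "sets (shadow_measure k X) = sets borel"
    by (simp add: shadow_measure_def)
  show SA: "shadow k (A \<inter> X) \<in> sets borel" if "A \<in> sets borel" for A
    using measurable_sets[OF h that] S
    by (simp add: space_restrict_space pre sets_restrict_space_iff)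
  show eA: "emeasure (shadow_measure k X) A = emeasure lborel (shadow k (A \<inter> X))" if "A \<in> sets borel" for A
    using that S SA[OF that] h' unfolding shadow_measure_def
    by (subst emeasure_distr) (auto simp: space_restrict_space pre emeasure_restrict_space shadow_mono)
  show "finite_measure (shadow_measure k X)"
  proof
    have "emeasure (shadow_measure k X) UNIV < \<infinity>"
      using emeasure_compact_finite[OF cS] by (simp add: eA)
    then show "emeasure (shadow_measure k X) (space (shadow_measure k X)) \<noteq> \<infinity>"
      by (simp add: shadow_measure_def)
  qed
qed

lemma emeasure_lborel_vimage_plus:
  fixes a :: "'a::euclidean_space"
  assumes "B \<in> sets borel"
  shows "emeasure lborel ((+) a -` B) = emeasure lborel B"
proof -
  have "emeasure lborel ((+) a -` B) = emeasure (distr lborel borel ((+) a)) B"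
    using assms by (subst emeasure_distr) auto
  then show ?thesis by (simp add: lborel_distr_plus)
qed

text \<open>Yields, piece by piece, that the zero set of the polynomial is Lebesgue null.\<close>

lemma inj_on_flat_null_sets:
  fixes X :: "(real ^ 'n::finite) set"
  assumes X: "compact X" "inj_on (flat k) X"
  shows "X \<in> null_sets lborel"
proof -
  define e :: "real ^ 'n" where "e = axis k 1"
  define T where "T n = (\<lambda>x. (1 / real (Suc n)) *\<^sub>R e + x) ` X" for n
  have T: "T n \<in> sets borel" "emeasure lborel (T n) = emeasure lborel X" for n
  proof -
    have cT: "compact (T n)" unfolding T_def by (rule compact_translation[OF X(1)])
    then show "T n \<in> sets borel" by (rule borel_compact)
    have "emeasure lborel X = emeasure lborel ((\<lambda>x. (1 / real (Suc n)) *\<^sub>R e + x) -` T n)"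
      by (rule arg_cong[of _ _ "emeasure lborel"]) (auto simp: T_def)
    also have "\<dots> = emeasure lborel (T n)"
      using cT by (intro emeasure_lborel_vimage_plus borel_compact)
    finally show "emeasure lborel (T n) = emeasure lborel X" by simp
  qed
  \<comment> \<open>Infinitely many disjoint translates of equal measure lie in a bounded set.\<close>
  have disj: "disjoint_family T"
    unfolding disjoint_family_on_def
  proof (intro ballI impI equals0I)
    fix m n :: nat and y assume "m \<noteq> n" "y \<in> T m \<inter> T n"
    then obtain x x' where x: "x \<in> X" "x' \<in> X" "y = x + (1 / real (Suc m)) *\<^sub>R e" "y = x' + (1 / real (Suc n)) *\<^sub>R e"
      by (auto simp: T_def add.commute)
    then have "flat k x = flat k x'" by (metis e_def flat_add_axis)
    then have "x = x'" using x X(2) by (auto dest: inj_onD)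
    then have "(1 / real (Suc m) - 1 / real (Suc n)) *\<^sub>R e = 0" using x by (auto simp: algebra_simps)
    then show False using \<open>m \<noteq> n\<close> by (simp add: e_def axis_eq_0_iff)
  qed
  obtain B where B: "\<And>x. x \<in> X \<Longrightarrow> norm x \<le> B"
    using compact_imp_bounded[OF X(1)] by (auto simp: bounded_iff)
  have "T n \<subseteq> cball 0 (B + 1)" for n
  proof -
    have "norm ((1 / real (Suc n)) *\<^sub>R e + x) \<le> B + 1" if "x \<in> X" for x
    proof -
      have "norm ((1 / real (Suc n)) *\<^sub>R e + x) \<le> norm ((1 / real (Suc n)) *\<^sub>R e) + norm x"
        by (rule norm_triangle_ineq)
      also have "\<dots> \<le> 1 + B" using B[OF that] by (intro add_mono) (auto simp: e_def)
      finally show ?thesis by simp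
    qed
    then show ?thesis by (auto simp: T_def)
  qed
  then have "suminf (\<lambda>n. emeasure lborel (T n)) \<le> emeasure lborel (cball (0 :: real ^ 'n) (B + 1))"
    using T(1) by (subst suminf_emeasure[OF _ disj]) (auto intro!: emeasure_mono)
  also have "\<dots> < \<infinity>" by (rule emeasure_lborel_cball_finite)
  finally have fin: "suminf (\<lambda>n::nat. emeasure lborel X) < \<infinity>" by (simp add: T)
  have "emeasure lborel X = 0"
  proof (rule ccontr)
    assume "emeasure lborel X \<noteq> 0"
    moreover have "emeasure lborel X < \<infinity>" using emeasure_compact_finite[OF X(1)] by simp
    ultimately obtain c where c: "emeasure lborel X = ennreal c" "c > 0"
      by (cases "emeasure lborel X") (auto simp: less_le)
    then have "summable (\<lambda>n::nat. c)"
      using fin by (intro summable_suminf_not_top) auto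
    then show False using c by (auto dest: summable_LIMSEQ_zero LIMSEQ_unique[OF tendsto_const])
  qed
  then show ?thesis using X by (simp add: null_sets_def borel_compact)
qed

section \<open>Regular zero sets\<close>

text \<open>On the segment in direction \<open>k\<close> through each point of the disc of radius
  \<open>c * r\<close> tangent at \<open>z\<close>, \<open>q\<close> changes sign. So the zero set
  in \<open>cball z r\<close> projects onto at least the shadow of that disc.\<close>

lemma emeasure_shadow_zeros_ge:
  fixes q :: "real ^ 'n::finite \<Rightarrow> real"
  assumes q: "continuous_on UNIV q" "(q has_derivative (\<lambda>h. g \<bullet> h)) (at z)" "q z = 0"
    and g: "g $ k \<noteq> 0" and c: "0 < c" "c < 1"
  shows "\<forall>\<^sub>F r in at_right 0.
    ennreal (\<bar>g $ k\<bar> / norm g * (unit_ball_vol (real (CARD('n) - 1)) * (c * r) ^ (CARD('n) - 1)))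
    \<le> emeasure lborel (shadow k ({x. q x = 0} \<inter> cball z r))"
proof -
  \<comment> \<open>At the ends of a segment of half length \<open>(1 - c) * r\<close> the linear
    part of \<open>q\<close> has size \<open>2 * \<epsilon> * r\<close>, which beats the error
    \<open>\<epsilon> * r\<close> and decides the sign. Disc radius and half length add up to
    \<open>r\<close>, so the segment stays in the ball.\<close>
  define \<epsilon> where "\<epsilon> = \<bar>g $ k\<bar> * (1 - c) / 2"
  have \<epsilon>: "\<epsilon> > 0" using g c by (simp add: \<epsilon>_def)
  obtain d where d: "d > 0" "\<And>h. norm h < d \<Longrightarrow> \<bar>q (z + h) - g \<bullet> h\<bar> \<le> \<epsilon> * norm h"
  proof -
    obtain d where "d > 0" "\<And>y. norm (y - z) < d \<Longrightarrow> norm (q y - q z - g \<bullet> (y - z)) \<le> \<epsilon> * norm (y - z)"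
      using q(2) \<epsilon> unfolding has_derivative_at_alt by blast
    from this(1) this(2)[of "z + h" for h] show ?thesis using that q(3) by auto
  qed
  have g0: "g \<noteq> 0" using g by auto
  have main: "ennreal (\<bar>g $ k\<bar> / norm g * (unit_ball_vol (real (CARD('n) - 1)) * (c * r) ^ (CARD('n) - 1)))
    \<le> emeasure lborel (shadow k ({x. q x = 0} \<inter> cball z r))" if r: "0 < r" "r < d" for r
  proof -
    define \<nu> where "\<nu> = g /\<^sub>R norm g"
    have \<nu>: "norm \<nu> = 1" using g0 by (simp add: \<nu>_def)
    have sgn: "0 < t * g $ k * q (z + (v + t *\<^sub>R axis k 1))" if v: "v \<in> disc \<nu> (c * r)" and t: "\<bar>t\<bar> = (1 - c) * r" for v t
    proof -
      have nh: "norm (v + t *\<^sub>R axis k 1) \<le> r"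
      proof -
        have "norm (v + t *\<^sub>R axis k 1) \<le> norm v + norm (t *\<^sub>R axis k (1::real))"
          by (rule norm_triangle_ineq)
        also have "\<dots> \<le> c * r + (1 - c) * r" using v t by (intro add_mono) (auto simp: disc_def)
        finally show ?thesis by (simp add: algebra_simps)
      qed
      have gv: "g \<bullet> v = 0" using v g0 by (simp add: disc_def \<nu>_def)
      have gh: "g \<bullet> (v + t *\<^sub>R axis k 1) = t * g $ k"
        using gv by (simp add: inner_add_right inner_axis)
      have "\<bar>q (z + (v + t *\<^sub>R axis k 1)) - t * g $ k\<bar> \<le> \<epsilon> * r"
        using d(2)[of "v + t *\<^sub>R axis k 1"] nh r \<epsilon> unfolding gh
        by (smt (verit) mult_left_mono)
      moreover have "\<bar>t * g $ k\<bar> = 2 * (\<epsilon> * r)"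
        using t by (simp add: abs_mult \<epsilon>_def)
      moreover have "\<epsilon> * r > 0" using \<epsilon> r by simp
      ultimately show ?thesis by (smt (verit) mult_pos_pos mult_neg_neg)
    qed
    \<comment> \<open>The translation is by \<open>flat k z\<close> instead of \<open>z\<close>, so
      that the \<open>k\<close>-th coordinate stays in the unit slab.\<close>
    have "shadow k (disc \<nu> (c * r)) \<subseteq> (+) (flat k z) -` shadow k ({x. q x = 0} \<inter> cball z r)"
    proof
      fix x assume "x \<in> shadow k (disc \<nu> (c * r))"
      then obtain s where x: "x $ k \<in> {0..1}" and v: "x + s *\<^sub>R axis k 1 \<in> disc \<nu> (c * r)"
        by (auto simp: shadow_def)
      define v where "v = x + s *\<^sub>R axis k 1"
      define t0 where "t0 = (1 - c) * r"
      \<comment> \<open>The factor \<open>g $ k\<close> makes the sign of \<open>f\<close> at the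
        two ends independent of the sign of \<open>g $ k\<close>.\<close>
      define f where "f t = g $ k * q (z + (v + t *\<^sub>R axis k 1))" for t
      have t0: "t0 > 0" using c r by (simp add: t0_def)
      have "0 < t0 * f t0" "0 < - t0 * f (- t0)"
        using sgn[OF v, of t0] sgn[OF v, of "- t0"] t0 unfolding f_def v_def mult.assoc by (simp_all add: t0_def)
      then have "0 < f t0" "f (- t0) < 0"
        using t0 by (auto simp: zero_less_mult_iff mult_less_0_iff)
      moreover have "continuous_on {- t0..t0} f"
        unfolding f_def by (intro continuous_intros continuous_on_compose2[OF q(1)]) auto
      ultimately obtain t where t: "- t0 \<le> t" "t \<le> t0" "f t = 0"
        using IVT'[of f "- t0" 0 t0] t0 by auto
      have "norm (v + t *\<^sub>R axis k 1) \<le> norm v + norm (t *\<^sub>R axis k (1::real))"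
        by (rule norm_triangle_ineq)
      also have "\<dots> \<le> c * r + t0" using v t by (intro add_mono) (auto simp: disc_def v_def)
      finally have "norm (v + t *\<^sub>R axis k 1) \<le> r" by (simp add: t0_def algebra_simps)
      then have "z + (v + t *\<^sub>R axis k 1) \<in> {x. q x = 0} \<inter> cball z r"
        using t(3) g by (simp add: f_def dist_norm norm_minus_cancel[of "v + _", symmetric] del: norm_minus_cancel)
      moreover have "z + (v + t *\<^sub>R axis k 1) = (flat k z + x) + (z $ k + s + t) *\<^sub>R axis k 1"
        by (simp add: v_def flat_def algebra_simps)
      ultimately show "x \<in> (+) (flat k z) -` shadow k ({x. q x = 0} \<inter> cball z r)"
        using x by (auto simp: shadow_def flat_nth)
    qed
    moreover have "closed {x. q x = 0}"
      using q(1) by (intro closed_Collect_eq) auto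
    then have cZ: "shadow k ({x. q x = 0} \<inter> cball z r) \<in> sets borel"
      by (intro borel_compact compact_shadow closed_Int_compact) auto
    ultimately have "emeasure lborel (shadow k (disc \<nu> (c * r)))
        \<le> emeasure lborel ((+) (flat k z) -` shadow k ({x. q x = 0} \<inter> cball z r))"
      using measurable_sets[of "(+) (flat k z)" borel borel, OF _ cZ] by (intro emeasure_mono) auto
    also have "\<dots> = emeasure lborel (shadow k ({x. q x = 0} \<inter> cball z r))"
      using cZ by (rule emeasure_lborel_vimage_plus)
    finally show ?thesis
      using emeasure_shadow_disc[OF \<nu>, of "c * r" k] c r
      by (simp add: \<nu>_def abs_mult divide_inverse_commute)
  qed
  show ?thesis
    using d(1) by (intro eventually_at_rightI[of 0 d]) (use main in auto)
qed


lemma tendsto_less_eventually: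
  fixes f g :: "'a \<Rightarrow> real"
  assumes "(f \<longlongrightarrow> a) F" "(g \<longlongrightarrow> b) F" "a < b"
  shows "\<forall>\<^sub>F x in F. f x < g x"
  using order_tendstoD(1)[OF tendsto_diff[OF assms(2,1)], of 0] assms(3) by simp

text \<open>Rolle's argument: between two zeros on a line in direction \<open>k\<close> the
  \<open>k\<close>-th partial derivative would vanish, and convexity keeps that point in
  \<open>S\<close>.\<close>

lemma inj_on_flat_zeros:
  fixes q :: "real ^ 'n::finite \<Rightarrow> real"
  assumes q: "\<And>x. (q has_derivative (\<lambda>h. G x \<bullet> h)) (at x)"
    and S: "convex S" "\<And>x. x \<in> S \<Longrightarrow> G x $ k \<noteq> 0"
  shows "inj_on (flat k) ({x. q x = 0} \<inter> S)"
proof (rule inj_onI)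
  fix x y assume x: "x \<in> {x. q x = 0} \<inter> S" and y: "y \<in> {x. q x = 0} \<inter> S" and "flat k x = flat k y"
  define t where "t = y $ k - x $ k"
  have y_eq: "y = x + t *\<^sub>R axis k 1"
    unfolding t_def by (rule flat_eqD) fact
  define f where "f u = q (x + u *\<^sub>R (t *\<^sub>R axis k 1))" for u
  have "(f has_real_derivative G (x + u *\<^sub>R (t *\<^sub>R axis k 1)) \<bullet> (t *\<^sub>R axis k 1)) (at u)" for u
    unfolding f_def has_field_derivative_def
    by (rule has_derivative_eq_rhs[OF has_derivative_compose[OF _ q]])
      (auto intro!: derivative_eq_intros simp: inner_axis)
  from MVT2[of 0 1 f, OF _ this]
  obtain u where u: "0 < u" "u < 1" "f 1 - f 0 = G (x + u *\<^sub>R (t *\<^sub>R axis k 1)) \<bullet> (t *\<^sub>R axis k 1)"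
    by auto
  have "x + u *\<^sub>R (t *\<^sub>R axis k 1) = (1 - u) *\<^sub>R x + u *\<^sub>R y"
    by (simp add: y_eq algebra_simps)
  also have "\<dots> \<in> S"
    using S(1) x y u by (intro convexD) auto
  finally have "G (x + u *\<^sub>R (t *\<^sub>R axis k 1)) $ k \<noteq> 0" by (rule S(2))
  moreover have "f 1 - f 0 = 0" using x y by (simp add: f_def y_eq)
  ultimately have "t = 0" using u(3) by (simp add: inner_axis)
  then show "x = y" by (simp add: y_eq)
qed

text \<open>\<open>K\<close> collects directions in which shadows are measurable and which together
  account for the Hausdorff measure up to the factor \<open>c\<close>. The bound is demanded of all
  Borel subsets, so that pieces can later be made disjoint and cut down to the cube.\<close>

definition regular_piece :: "real \<Rightarrow> (real ^ 'n::finite) set \<Rightarrow> bool" where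
  "regular_piece c W \<longleftrightarrow> W \<in> null_sets lborel \<and> (\<exists>K. \<forall>E\<in>sets borel. E \<subseteq> W \<longrightarrow>
     (\<forall>k\<in>K. shadow k E \<in> sets borel) \<and>
     ennreal c * hausdorff_measure (CARD('n) - 1) E \<le> (\<Sum>k\<in>K. emeasure lborel (shadow k E)))"

text \<open>One factor \<open>c\<close> pays for comparing the sum over \<open>K\<close> with
  \<open>norm (G x)\<close> away from \<open>z0\<close>, the remaining \<open>CARD('n) - 1\<close>
  factors for the disc radius \<open>c * r\<close>.\<close>

lemma regular_piece_zeros:
  fixes q :: "real ^ 'n::finite \<Rightarrow> real"
  assumes q: "\<And>x. (q has_derivative (\<lambda>h. G x \<bullet> h)) (at x)" and G: "continuous_on UNIV G"
    and z0: "G z0 \<noteq> 0" and c: "0 < c" "c < 1"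
  shows "\<exists>R>0. regular_piece (c ^ CARD('n)) ({x. q x = 0} \<inter> ball z0 R)"
proof -
  define K where "K = {k. G z0 $ k \<noteq> 0}"
  have qc: "continuous_on UNIV q"
    by (intro continuous_at_imp_continuous_on ballI has_derivative_continuous[OF q])
  have K0: "K \<noteq> {}" using z0 by (auto simp: K_def vec_eq_iff)
  have "norm (G z0) \<le> (\<Sum>k\<in>UNIV. \<bar>G z0 $ k\<bar>)" by (rule norm_le_l1_cart)
  also have "\<dots> = (\<Sum>k\<in>K. \<bar>G z0 $ k\<bar>)" by (rule sum.mono_neutral_right) (auto simp: K_def)
  finally have "norm (G z0) \<le> (\<Sum>k\<in>K. \<bar>G z0 $ k\<bar>)" .
  moreover have "c * norm (G z0) < 1 * norm (G z0)"
    using z0 c by (intro mult_strict_right_mono) auto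
  \<comment> \<open>Near \<open>z0\<close> components outside \<open>K\<close> may become nonzero,
    so the sum over \<open>K\<close> may drop below the norm. The strict inequality with
    \<open>c\<close> survives by continuity.\<close>
  ultimately have nK: "c * norm (G z0) < (\<Sum>k\<in>K. \<bar>G z0 $ k\<bar>)" by simp
  have Gt: "(G \<longlongrightarrow> G z0) (nhds z0)"
    using G by (simp add: continuous_on_eq_continuous_at isCont_def tendsto_nhds_iff)
  have "\<forall>\<^sub>F x in nhds z0. c * norm (G x) < (\<Sum>k\<in>K. \<bar>G x $ k\<bar>)"
    by (rule tendsto_less_eventually[OF _ _ nK]) (intro tendsto_intros Gt)+
  moreover have "\<forall>\<^sub>F x in nhds z0. \<forall>k\<in>K. G x $ k \<noteq> 0"
    by (intro eventually_ball_finite) (auto simp: K_def intro!: tendsto_imp_eventually_ne[OF tendsto_vec_nth[OF Gt]])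
  ultimately have "\<forall>\<^sub>F x in nhds z0. c * norm (G x) < (\<Sum>k\<in>K. \<bar>G x $ k\<bar>) \<and> (\<forall>k\<in>K. G x $ k \<noteq> 0)"
    by eventually_elim simp
  then obtain R' where R': "R' > 0" "\<And>x. dist x z0 < R' \<Longrightarrow> c * norm (G x) < (\<Sum>k\<in>K. \<bar>G x $ k\<bar>) \<and> (\<forall>k\<in>K. G x $ k \<noteq> 0)"
    unfolding eventually_nhds_metric by blast
  \<comment> \<open>Halving puts the closed ball inside the neighbourhood, which makes
    \<open>X\<close> compact.\<close>
  define R where "R = R' / 2"
  have R: "R > 0" using R' by (simp add: R_def)
  have Rx: "c * norm (G x) < (\<Sum>k\<in>K. \<bar>G x $ k\<bar>)" "\<And>k. k \<in> K \<Longrightarrow> G x $ k \<noteq> 0" if "x \<in> cball z0 R" for x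
    using that R'(2)[of x] R'(1) by (auto simp: R_def dist_commute)
  define X where "X = {x. q x = 0} \<inter> cball z0 R"
  have cl: "closed {x. q x = 0}" using qc by (intro closed_Collect_eq) auto
  then have X: "compact X" unfolding X_def by (intro closed_Int_compact) auto
  have injX: "inj_on (flat k) X" if "k \<in> K" for k
    unfolding X_def using Rx(2) that by (intro inj_on_flat_zeros[OF q]) auto
  have WX: "{x. q x = 0} \<inter> ball z0 R \<subseteq> X" by (auto simp: X_def)
  have "{x. q x = 0} \<inter> ball z0 R \<in> null_sets lborel"
  proof -
    obtain k where "k \<in> K" using K0 by blast
    then have "X \<in> null_sets lborel" using inj_on_flat_null_sets[OF X injX] by blast
    then show ?thesis using cl WX by (rule_tac null_sets_subset) auto
  qed
  moreover have "(\<forall>k\<in>K. shadow k E \<in> sets borel) \<and>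
     ennreal (c ^ CARD('n)) * hausdorff_measure (CARD('n) - 1) E \<le> (\<Sum>k\<in>K. emeasure lborel (shadow k E))"
    if E: "E \<in> sets borel" "E \<subseteq> {x. q x = 0} \<inter> ball z0 R" for E
  proof
    have EX: "E \<inter> X = E" using E(2) WX by blast
    show "\<forall>k\<in>K. shadow k E \<in> sets borel"
      using shadow_borel[OF X injX E(1)] EX by simp
    have dens: "\<forall>\<^sub>F r in at_right 0. ennreal (c ^ CARD('n) * (unit_ball_vol (real (CARD('n) - 1)) * r ^ (CARD('n) - 1)))
        \<le> (\<Sum>k\<in>K. emeasure (shadow_measure k X) (cball z r))" if z: "z \<in> E" for z
    proof -
      have qz: "q z = 0" and zb: "z \<in> ball z0 R" using z E by auto
      have "\<forall>\<^sub>F r in at_right 0. \<forall>k\<in>K.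
          ennreal (\<bar>G z $ k\<bar> / norm (G z) * (unit_ball_vol (real (CARD('n) - 1)) * (c * r) ^ (CARD('n) - 1)))
          \<le> emeasure lborel (shadow k ({x. q x = 0} \<inter> cball z r))"
        using Rx(2)[of z] zb by (intro eventually_ball_finite ballI emeasure_shadow_zeros_ge[OF qc q qz _ c]) auto
      moreover obtain d where "d > 0" "cball z d \<subseteq> ball z0 R"
        using zb by (meson open_ball open_contains_cball)
      then have "\<forall>\<^sub>F r in at_right 0. 0 < r \<and> cball z r \<subseteq> ball z0 R"
        by (intro eventually_at_rightI[of 0 d]) (auto intro: order.trans[OF subset_cball])
      ultimately show ?thesis
      proof eventually_elim
        case (elim r)
        have Gz: "norm (G z) > 0" using Rx(2)[of z] zb K0 by auto
        have nn: "0 \<le> unit_ball_vol (real (CARD('n) - 1)) * (c * r) ^ (CARD('n) - 1)" 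
          using elim c by simp
        have "c ^ CARD('n) = c * c ^ (CARD('n) - 1)"
          using zero_less_card_finite[where 'a='n] by (metis Suc_pred' power_Suc)
        then have "c ^ CARD('n) * (unit_ball_vol (real (CARD('n) - 1)) * r ^ (CARD('n) - 1))
            = c * (unit_ball_vol (real (CARD('n) - 1)) * (c * r) ^ (CARD('n) - 1))"
          by (simp add: power_mult_distrib)
        also have "\<dots> \<le> (\<Sum>k\<in>K. \<bar>G z $ k\<bar>) / norm (G z) * (unit_ball_vol (real (CARD('n) - 1)) * (c * r) ^ (CARD('n) - 1))"
          using Rx(1)[of z] zb Gz nn by (intro mult_right_mono) (auto simp: field_simps)
        also have "\<dots> = (\<Sum>k\<in>K. \<bar>G z $ k\<bar> / norm (G z) * (unit_ball_vol (real (CARD('n) - 1)) * (c * r) ^ (CARD('n) - 1)))"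
          by (simp add: sum_divide_distrib sum_distrib_right)
        finally have "ennreal (c ^ CARD('n) * (unit_ball_vol (real (CARD('n) - 1)) * r ^ (CARD('n) - 1)))
          \<le> ennreal (\<Sum>k\<in>K. \<bar>G z $ k\<bar> / norm (G z) * (unit_ball_vol (real (CARD('n) - 1)) * (c * r) ^ (CARD('n) - 1)))"
          by (rule ennreal_leI)
        also have "\<dots> = (\<Sum>k\<in>K. ennreal (\<bar>G z $ k\<bar> / norm (G z) * (unit_ball_vol (real (CARD('n) - 1)) * (c * r) ^ (CARD('n) - 1))))"
          using elim c by (intro sum_ennreal[symmetric] mult_nonneg_nonneg divide_nonneg_nonneg) auto
        also have "\<dots> \<le> (\<Sum>k\<in>K. emeasure lborel (shadow k ({x. q x = 0} \<inter> cball z r)))"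
          using elim by (intro sum_mono) auto
        also have "\<dots> = (\<Sum>k\<in>K. emeasure (shadow_measure k X) (cball z r))"
        proof (rule sum.cong[OF refl])
          have "{x. q x = 0} \<inter> cball z r = cball z r \<inter> X"
            using elim ball_subset_cball[of z0 R] by (auto simp: X_def)
          then show "emeasure lborel (shadow k ({x. q x = 0} \<inter> cball z r)) = emeasure (shadow_measure k X) (cball z r)"
            if "k \<in> K" for k using emeasure_shadow_measure[OF X injX[OF that]] by simp
        qed
        finally show ?case .
      qed
    qed
    have "ennreal (c ^ CARD('n)) * hausdorff_measure (CARD('n) - 1) E \<le> (\<Sum>k\<in>K. emeasure (shadow_measure k X) E)"
      using c E(1) X injX dens
      by (intro hausdorff_measure_le_density) (auto simp: sets_shadow_measure finite_shadow_measure)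
    also have "\<dots> = (\<Sum>k\<in>K. emeasure lborel (shadow k E))"
      using emeasure_shadow_measure[OF X injX E(1)] EX by simp
    finally show "ennreal (c ^ CARD('n)) * hausdorff_measure (CARD('n) - 1) E \<le> (\<Sum>k\<in>K. emeasure lborel (shadow k E))" .
  qed
  ultimately have "regular_piece (c ^ CARD('n)) ({x. q x = 0} \<inter> ball z0 R)"
    unfolding regular_piece_def by blast
  with R show ?thesis by blast
qed

section \<open>Iterated partial derivatives\<close>

lemma hausdorff_measure_empty [simp]: "hausdorff_measure s {} = 0"
proof -
  have "hausdorff_content s \<delta> {} = 0" if "\<delta> > 0" for \<delta>
    using hausdorff_content_le_suminf[of "{}" "\<lambda>_. {}" \<delta> s] that by (simp add: hausdorff_weight_def)
  then have "hausdorff_measure s {} = (SUP \<delta>\<in>{0::real<..}. 0)"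
    unfolding hausdorff_measure_def by (intro SUP_cong) auto
  then show ?thesis by simp
qed

lemma regular_piece_empty: "regular_piece c {}"
  unfolding regular_piece_def by (intro conjI exI[of _ "{}"]) auto

definition partial :: "'n::finite \<Rightarrow> (real ^ 'n \<Rightarrow> real) \<Rightarrow> real ^ 'n \<Rightarrow> real" where
  "partial k f x = frechet_derivative f (at x) (axis k 1)"

text \<open>Polynomial components of the gradient are what allows differentiation to be
  iterated.\<close>

lemma real_polynomial_function_gradient:
  fixes f :: "real ^ 'n::finite \<Rightarrow> real"
  assumes "real_polynomial_function f"
  shows "\<exists>G. (\<forall>k. real_polynomial_function (\<lambda>x. G x $ k)) \<and> (\<forall>x. (f has_derivative (\<lambda>h. G x \<bullet> h)) (at x))"
  using assms
proof induction
  case (linear f)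
  have eq: "f h = (\<chi> i. f (axis i 1)) \<bullet> h" for h
  proof -
    have "f h = f (\<Sum>i\<in>UNIV. h $ i *\<^sub>R axis i 1)"
      by (simp flip: scalar_mult_eq_scaleR add: basis_expansion)
    also have "\<dots> = (\<Sum>i\<in>UNIV. h $ i * f (axis i 1))"
      using bounded_linear.linear[OF linear] by (simp add: linear_sum linear_scale)
    finally show ?thesis by (simp add: inner_vec_def mult.commute)
  qed
  have "(\<lambda>h. (\<chi> i. f (axis i 1)) \<bullet> h) = f" by (rule ext) (rule eq[symmetric])
  then show ?case
    using bounded_linear.has_derivative[OF linear has_derivative_ident]
    by (intro exI[of _ "\<lambda>x. \<chi> i. f (axis i 1)"]) (simp add: real_polynomial_function.intros(2))
next
  case (const c)
  show ?case by (intro exI[of _ "\<lambda>x. 0"]) (auto simp: real_polynomial_function.intros(2))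
next
  case (add f g)
  then obtain F G where
    "\<And>k. real_polynomial_function (\<lambda>x. F x $ k)" "\<And>x. (f has_derivative (\<lambda>h. F x \<bullet> h)) (at x)"
    "\<And>k. real_polynomial_function (\<lambda>x. G x $ k)" "\<And>x. (g has_derivative (\<lambda>h. G x \<bullet> h)) (at x)"
    by blast
  then show ?case
    by (intro exI[of _ "\<lambda>x. F x + G x"]) (auto simp: inner_add_left intro!: derivative_eq_intros)
next
  case (mult f g)
  then obtain F G where
    "\<And>k. real_polynomial_function (\<lambda>x. F x $ k)" "\<And>x. (f has_derivative (\<lambda>h. F x \<bullet> h)) (at x)"
    "\<And>k. real_polynomial_function (\<lambda>x. G x $ k)" "\<And>x. (g has_derivative (\<lambda>h. G x \<bullet> h)) (at x)"
    by blast
  with mult.hyps show ?case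
    by (intro exI[of _ "\<lambda>x. f x *\<^sub>R G x + g x *\<^sub>R F x"])
      (auto simp: inner_add_left intro!: derivative_eq_intros real_polynomial_function.intros(3,4))
qed

lemma
  fixes f :: "real ^ 'n::finite \<Rightarrow> real"
  assumes "real_polynomial_function f"
  shows real_polynomial_function_partial: "real_polynomial_function (partial k f)"
    and has_derivative_partial: "(f has_derivative (\<lambda>h. (\<chi> k. partial k f x) \<bullet> h)) (at x)"
proof -
  obtain G where G: "\<And>k. real_polynomial_function (\<lambda>x. G x $ k)"
      "\<And>x. (f has_derivative (\<lambda>h. G x \<bullet> h)) (at x)"
    using real_polynomial_function_gradient[OF assms] by blast
  have "frechet_derivative f (at x) = (\<lambda>h. G x \<bullet> h)" for x
    using frechet_derivative_at[OF G(2)] by simp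
  then have p: "partial k f x = G x $ k" for k x
    by (simp add: partial_def inner_axis)
  then have "partial k f = (\<lambda>x. G x $ k)" for k by auto
  then show "real_polynomial_function (partial k f)" using G(1) by simp
  have "(\<chi> k. partial k f x) = G x" by (simp add: p vec_eq_iff)
  then show "(f has_derivative (\<lambda>h. (\<chi> k. partial k f x) \<bullet> h)) (at x)" using G(2) by simp
qed

definition partials :: "'n::finite list \<Rightarrow> (real ^ 'n \<Rightarrow> real) \<Rightarrow> real ^ 'n \<Rightarrow> real" where
  "partials l f = foldr partial l f"

lemma partials_simps [simp]:
  "partials [] f = f" "partials (k # l) f = partial k (partials l f)"
  by (simp_all add: partials_def)

lemma real_polynomial_function_partials:
  "real_polynomial_function f \<Longrightarrow> real_polynomial_function (partials l f)"
  by (induction l) (auto intro: real_polynomial_function_partial)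

lemma real_polynomial_function_line:
  fixes f :: "real ^ 'n::finite \<Rightarrow> real"
  assumes "real_polynomial_function f"
  shows "\<exists>P. \<forall>t. poly P t = f (z + t *\<^sub>R v)"
proof -
  have "polynomial_function (\<lambda>t::real. z + t *\<^sub>R v)"
    by (intro polynomial_function_add polynomial_function_const polynomial_function_bounded_linear bounded_linear_scaleR_left)
  from real_polynomial_function_compose[OF this assms]
  obtain a n where "f \<circ> (\<lambda>t. z + t *\<^sub>R v) = (\<lambda>x. \<Sum>i\<le>n. a i * x ^ i)"
    unfolding real_polynomial_function_iff_sum by blast
  then have "poly (\<Sum>i\<le>n. monom (a i) i) t = f (z + t *\<^sub>R v)" for t
    by (simp add: poly_sum poly_monom fun_eq_iff)
  then show ?thesis by blast
qed

text \<open>A Taylor argument on the line from \<open>z\<close> to \<open>x\<close>: by the chain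
  rule the derivative of \<open>P l\<close> is a combination of the \<open>P (k # l)\<close>. If all
  constant coefficients vanish, induction on the exponent kills all coefficients of every
  \<open>P l\<close>, contradicting \<open>f x \<noteq> 0\<close>.\<close>

lemma exists_partials_nonzero:
  fixes f :: "real ^ 'n::finite \<Rightarrow> real"
  assumes f: "real_polynomial_function f" and x: "f x \<noteq> 0"
  shows "\<exists>l. partials l f z \<noteq> 0"
proof (rule ccontr)
  assume "\<not> ?thesis"
  then have zero: "\<And>l. partials l f z = 0" by blast
  define v where "v = x - z"
  have "\<exists>P. \<forall>t. poly P t = partials l f (z + t *\<^sub>R v)" for l
    by (intro real_polynomial_function_line real_polynomial_function_partials f)
  then obtain P where P: "\<And>l t. poly (P l) t = partials l f (z + t *\<^sub>R v)"
    by metis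
  have dP: "pderiv (P l) = (\<Sum>k\<in>UNIV. smult (v $ k) (P (k # l)))" for l
  proof -
    have "poly (pderiv (P l)) t = poly (\<Sum>k\<in>UNIV. smult (v $ k) (P (k # l))) t" for t
    proof -
      have "(poly (P l) has_real_derivative (\<chi> k. partial k (partials l f) (z + t *\<^sub>R v)) \<bullet> v) (at t)"
        unfolding P[abs_def] has_field_derivative_def
        by (rule has_derivative_eq_rhs[OF has_derivative_compose[OF _ 
              has_derivative_partial[OF real_polynomial_function_partials[OF f]]]])
          (auto intro!: derivative_eq_intros)
      then have "poly (pderiv (P l)) t = (\<chi> k. partial k (partials l f) (z + t *\<^sub>R v)) \<bullet> v"
        using poly_DERIV DERIV_unique by blast
      then show ?thesis
        by (simp add: poly_sum P inner_vec_def mult.commute)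
    qed
    then show ?thesis by (simp add: poly_eq_poly_eq_iff[symmetric] fun_eq_iff)
  qed
  have "coeff (P l) n = 0" for l n
  proof (induction n arbitrary: l)
    case 0
    then show ?case using P[of l 0] zero by (simp add: poly_0_coeff_0)
  next
    case (Suc n)
    have "of_nat (Suc n) * coeff (P l) (Suc n) = coeff (pderiv (P l)) n"
      by (simp add: coeff_pderiv)
    also have "\<dots> = 0" unfolding dP by (simp add: coeff_sum Suc)
    finally show ?case by (simp del: of_nat_Suc)
  qed
  then have "P [] = 0" by (simp add: poly_eq_iff)
  then show False using P[of "[]" 1] x by (simp add: v_def)
qed

text \<open>Along the successive derivatives named by the list, the value at \<open>z\<close> starts
  at zero and ends nonzero; the step where it leaves zero gives \<open>l\<close> and
  \<open>k\<close>.\<close>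

lemma exists_partials_regular_zero:
  fixes f :: "real ^ 'n::finite \<Rightarrow> real"
  assumes f: "real_polynomial_function f" and x: "f x \<noteq> 0" and z: "f z = 0"
  shows "\<exists>l k. partials l f z = 0 \<and> partial k (partials l f) z \<noteq> 0"
proof -
  obtain l where "partials l f z \<noteq> 0" using exists_partials_nonzero[OF f x] by blast
  then show ?thesis
  proof (induction l)
    case Nil
    then show ?case using z by simp
  next
    case (Cons k l)
    then show ?case by (cases "partials l f z = 0") auto
  qed
qed

text \<open>There are countably many lists \<open>l\<close>, and for each the Lindelof property
  leaves countably many balls covering the points where \<open>G l\<close> does not vanish.\<close>

lemma countable_regular_pieces:
  fixes f :: "real ^ 'n::finite \<Rightarrow> real"
  assumes f: "real_polynomial_function f" and x: "f x \<noteq> 0" and c: "0 < c" "c < 1"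
  shows "\<exists>W :: nat \<Rightarrow> _. (\<forall>n. regular_piece (c ^ CARD('n)) (W n)) \<and> {z. f z = 0} \<subseteq> (\<Union>n. W n)"
proof -
  define q where "q l = partials l f" for l
  define G where "G l x = (\<chi> k. partial k (q l) x)" for l x
  have qp: "real_polynomial_function (q l)" for l
    unfolding q_def by (rule real_polynomial_function_partials[OF f])
  have qd: "(q l has_derivative (\<lambda>h. G l x \<bullet> h)) (at x)" for l x
    unfolding G_def by (rule has_derivative_partial[OF qp])
  have Gc: "continuous_on UNIV (G l)" for l
    unfolding G_def
    by (intro continuous_on_vec_lambda continuous_on_polymonial_function real_polynomial_function_partial qp
        real_polynomial_function_eq[THEN iffD1])
  have "\<exists>R>0. regular_piece (c ^ CARD('n)) ({x. q l x = 0} \<inter> ball z R)" if "G l z \<noteq> 0" for l z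
    by (rule regular_piece_zeros[OF qd Gc that c])
  then obtain R where R: "\<And>l z. G l z \<noteq> 0 \<Longrightarrow> R l z > 0"
    "\<And>l z. G l z \<noteq> 0 \<Longrightarrow> regular_piece (c ^ CARD('n)) ({x. q l x = 0} \<inter> ball z (R l z))"
    by metis
  have "\<exists>F. F \<subseteq> (\<lambda>z. ball z (R l z)) ` {z. G l z \<noteq> 0} \<and> countable F \<and>
      \<Union>F = \<Union>((\<lambda>z. ball z (R l z)) ` {z. G l z \<noteq> 0})" for l
    by (rule Lindelof[of "(\<lambda>z. ball z (R l z)) ` {z. G l z \<noteq> 0}"]) auto
  then have "\<forall>l. \<exists>F. F \<subseteq> (\<lambda>z. ball z (R l z)) ` {z. G l z \<noteq> 0} \<and> countable F \<and>
      \<Union>F = \<Union>((\<lambda>z. ball z (R l z)) ` {z. G l z \<noteq> 0})" by (rule allI)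
  from choice[OF this] obtain F where
    "\<forall>l. F l \<subseteq> (\<lambda>z. ball z (R l z)) ` {z. G l z \<noteq> 0} \<and> countable (F l) \<and>
      \<Union>(F l) = \<Union>((\<lambda>z. ball z (R l z)) ` {z. G l z \<noteq> 0})" by (rule exE)
  note F' = this[rule_format]
  note F = F'[THEN conjunct1] F'[THEN conjunct2, THEN conjunct1] F'[THEN conjunct2, THEN conjunct2]
  \<comment> \<open>Inserting the empty set makes the family nonempty, so that it is the range of a
    sequence.\<close>
  define \<W> where "\<W> = insert {} (\<Union>l. (\<lambda>B. {x. q l x = 0} \<inter> B) ` F l)"
  have "countable \<W>" unfolding \<W>_def using F(2) by auto
  have "regular_piece (c ^ CARD('n)) W" if "W \<in> \<W>" for W
    using that F(1) R(2) unfolding \<W>_def by (auto simp: regular_piece_empty)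
  moreover have "{z. f z = 0} \<subseteq> \<Union>\<W>"
  proof
    fix z assume "z \<in> {z. f z = 0}"
    then obtain l k where l: "q l z = 0" "partial k (q l) z \<noteq> 0"
      using exists_partials_regular_zero[OF f x] unfolding q_def by blast
    then have "G l z \<noteq> 0" by (auto simp: G_def vec_eq_iff)
    then have "z \<in> \<Union>(F l)" unfolding F(3) using R(1) by auto
    with l show "z \<in> \<Union>\<W>" unfolding \<W>_def by blast
  qed
  moreover have "range (from_nat_into \<W>) = \<W>"
    using \<open>countable \<W>\<close> by (intro range_from_nat_into) (auto simp: \<W>_def)
  ultimately show ?thesis by (intro exI[of _ "from_nat_into \<W>"]) (metis rangeI)
qed

section \<open>Counting zeros on lines\<close>

lemma real_polynomial_function_mpoly_eval:
  "real_polynomial_function (mpoly_eval p)" for p :: "'n::finite real_mpoly"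
proof -
  have "real_polynomial_function (\<lambda>x. x $ i)" for i :: "'n"
    by (intro real_polynomial_function.intros(1) bounded_linear_vec_nth)
  then show ?thesis
    unfolding mpoly_eval_def[abs_def]
    by (intro real_polynomial_function_sum real_polynomial_function.intros(4) real_polynomial_function.intros(2)
        real_polynomial_function_prod real_polynomial_function_power) auto
qed

text \<open>Restricted to the line, the polynomial is univariate in \<open>t\<close>; its value at
  \<open>t = 0\<close> is \<open>mpoly_eval p x\<close>, so it is not the zero polynomial.\<close>

lemma
  fixes p :: "'n::finite real_mpoly"
  assumes "mpoly_eval p x \<noteq> 0"
  shows finite_zeros_on_line: "finite {t. mpoly_eval p (x + t *\<^sub>R axis k 1) = 0}"
    and card_zeros_on_line: "card {t. mpoly_eval p (x + t *\<^sub>R axis k 1) = 0} \<le> mpoly_degree_in p k"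
proof -
  define U where "U = (\<Sum>m\<in>Poly_Mapping.keys p. smult (Poly_Mapping.lookup p m * (\<Prod>i\<in>UNIV - {k}. (x $ i) ^ Poly_Mapping.lookup m i))
      ([:x $ k, 1:] ^ Poly_Mapping.lookup m k))"
  have U: "poly U t = mpoly_eval p (x + t *\<^sub>R axis k 1)" for t
  proof -
    have "(\<Prod>i\<in>UNIV. ((x + t *\<^sub>R axis k 1) $ i) ^ Poly_Mapping.lookup m i) =
        (\<Prod>i\<in>UNIV - {k}. (x $ i) ^ Poly_Mapping.lookup m i) * (x $ k + t) ^ Poly_Mapping.lookup m k" for m
      by (subst prod.remove[of UNIV k]) (auto simp: axis_def intro!: prod.cong)
    then show ?thesis
      by (simp add: U_def mpoly_eval_def poly_sum mult.assoc)
  qed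
  have "U \<noteq> 0" using U[of 0] assms by auto
  have eq: "{t. mpoly_eval p (x + t *\<^sub>R axis k 1) = 0} = {t. poly U t = 0}" by (simp add: U)
  show "finite {t. mpoly_eval p (x + t *\<^sub>R axis k 1) = 0}"
    unfolding eq by (rule poly_roots_finite) fact
  have "degree U \<le> mpoly_degree_in p k"
    unfolding U_def
  proof (rule degree_sum_le)
    fix m assume m: "m \<in> Poly_Mapping.keys p"
    have "degree (smult (Poly_Mapping.lookup p m * (\<Prod>i\<in>UNIV - {k}. (x $ i) ^ Poly_Mapping.lookup m i))
      ([:x $ k, 1:] ^ Poly_Mapping.lookup m k)) \<le> degree ([:x $ k, 1:] ^ Poly_Mapping.lookup m k)"
      by (rule degree_smult_le)
    also have "\<dots> \<le> Poly_Mapping.lookup m k"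
      using degree_power_le[of "[:x $ k, 1:]" "Poly_Mapping.lookup m k"] by simp
    also have "\<dots> \<le> mpoly_degree_in p k"
      unfolding mpoly_degree_in_def using m by (intro Max_ge) auto
    finally show "degree (smult (Poly_Mapping.lookup p m * (\<Prod>i\<in>UNIV - {k}. (x $ i) ^ Poly_Mapping.lookup m i))
      ([:x $ k, 1:] ^ Poly_Mapping.lookup m k)) \<le> mpoly_degree_in p k" .
  qed simp
  then show "card {t. mpoly_eval p (x + t *\<^sub>R axis k 1) = 0} \<le> mpoly_degree_in p k"
    unfolding eq using card_poly_roots_bound[OF \<open>U \<noteq> 0\<close>] by linarith
qed

lemma emeasure_slab_box:
  fixes k :: "'n::finite"
  assumes "a < b"
  shows "emeasure lborel (cbox (\<chi> i. if i = k then 0 else a) (\<chi> i. if i = k then 1 else b)) = ennreal ((b - a) ^ (CARD('n) - 1))"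
proof -
  have "emeasure lborel (cbox (\<chi> i. if i = k then 0 else a) (\<chi> i. if i = k then 1 else b)) =
    ennreal (\<Prod>j\<in>Basis. ((\<chi> i. if i = k then 1 else b) - (\<chi> i. if i = k then 0 else a)) \<bullet> j)"
    using assms by (intro emeasure_lborel_cbox) (auto simp: Basis_vec_def inner_axis)
  also have "(\<Prod>j\<in>Basis. ((\<chi> i. if i = k then 1 else b) - (\<chi> i. if i = k then 0 else a)) \<bullet> j) =
    (\<Prod>i\<in>UNIV. if i = k then 1 else b - a)"
    by (auto simp: prod_Basis_cart inner_axis intro!: prod.cong)
  also have "\<dots> = (\<Prod>i\<in>UNIV - {k}. b - a)"
    by (subst prod.remove[of UNIV k]) (auto intro!: prod.cong)
  finally show ?thesis by (simp add: card_Diff_singleton)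
qed

text \<open>A point of each piece met is chosen on the line; disjointness makes these zeros
  distinct.\<close>

lemma card_pieces_on_line:
  fixes p :: "'n::finite real_mpoly"
  assumes x: "mpoly_eval p x \<noteq> 0" and E: "disjoint_family E" "\<And>n. E n \<subseteq> zero_set p"
  shows "finite {n. x \<in> shadow k (E n)}" "card {n. x \<in> shadow k (E n)} \<le> mpoly_degree_in p k"
proof -
  let ?S = "{n. x \<in> shadow k (E n)}" and ?T = "{t. mpoly_eval p (x + t *\<^sub>R axis k 1) = 0}"
  have "\<forall>n\<in>?S. \<exists>t. x + t *\<^sub>R axis k 1 \<in> E n" by (auto simp: shadow_def)
  then obtain \<tau> where \<tau>: "\<And>n. n \<in> ?S \<Longrightarrow> x + \<tau> n *\<^sub>R axis k 1 \<in> E n" by metis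
  have inj: "inj_on \<tau> ?S"
  proof (rule inj_onI)
    fix m n assume "m \<in> ?S" "n \<in> ?S" "\<tau> m = \<tau> n"
    then have "E m \<inter> E n \<noteq> {}" using \<tau>[of m] \<tau>[of n] by auto
    then show "m = n" using E(1) by (auto simp: disjoint_family_on_def)
  qed
  moreover have sub: "\<tau> ` ?S \<subseteq> ?T" using \<tau> E(2) by (fastforce simp: zero_set_def)
  ultimately show "finite ?S"
    using finite_zeros_on_line[OF x] by (meson finite_imageD finite_subset)
  show "card ?S \<le> mpoly_degree_in p k"
    using card_inj_on_le[OF inj sub finite_zeros_on_line[OF x]] card_zeros_on_line[OF x, of k] by linarith
qed

text \<open>By Tonelli the sum is the integral of the number of shadows containing \<open>x\<close>,
  at most the degree for almost every \<open>x\<close> and zero outside the unit-thick slab over a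
  face of the cube. \<open>N\<close> stands for the pieces that admit the direction
  \<open>k\<close>.\<close>

lemma suminf_shadows_le:
  fixes p :: "'n::finite real_mpoly"
  assumes null: "zero_set p \<in> null_sets lborel" and "a < b"
    and E: "disjoint_family E" "\<And>n. E n \<subseteq> zero_set p \<inter> {x. \<forall>i. x $ i \<in> {a..b}}"
    and N: "\<And>n. n \<in> N \<Longrightarrow> shadow k (E n) \<in> sets borel"
  shows "suminf (\<lambda>n. if n \<in> N then emeasure lborel (shadow k (E n)) else 0)
    \<le> ennreal (real (mpoly_degree_in p k) * (b - a) ^ (CARD('n) - 1))"
proof -
  define B :: "(real ^ 'n) set" where "B = cbox (\<chi> i. if i = k then 0 else a) (\<chi> i. if i = k then 1 else b)"
  define f where "f n x = (if n \<in> N then indicator (shadow k (E n)) x else 0 :: ennreal)" for n x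
  have f: "f n \<in> borel_measurable lborel" for n
    using N by (cases "n \<in> N") (auto simp: f_def[abs_def])
  have "suminf (\<lambda>n. if n \<in> N then emeasure lborel (shadow k (E n)) else 0) = suminf (\<lambda>n. \<integral>\<^sup>+x. f n x \<partial>lborel)"
    using N by (intro arg_cong[of _ _ suminf] ext) (auto simp: f_def)
  also have "\<dots> = (\<integral>\<^sup>+x. suminf (\<lambda>n. f n x) \<partial>lborel)"
    using f by (rule nn_integral_suminf[symmetric])
  also have "\<dots> \<le> (\<integral>\<^sup>+x. of_nat (mpoly_degree_in p k) * indicator B x \<partial>lborel)"
  proof (rule nn_integral_mono_AE)
    \<comment> \<open>This also discards the lines on which \<open>p\<close> vanishes identically.\<close>
    have "AE x in lborel. x \<notin> zero_set p" using null by (rule AE_not_in)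
    then show "AE x in lborel. suminf (\<lambda>n. f n x) \<le> of_nat (mpoly_degree_in p k) * indicator B x"
    proof eventually_elim
      case (elim x)
      let ?S = "{n. x \<in> shadow k (E n)}"
      have px: "mpoly_eval p x \<noteq> 0" using elim by (simp add: zero_set_def)
      have EZ: "E n \<subseteq> zero_set p" for n using E(2) by blast
      note S = card_pieces_on_line[OF px E(1) EZ, of k]
      have "suminf (\<lambda>n. f n x) = (\<Sum>n\<in>?S. f n x)"
        by (rule suminf_finite[OF S(1)]) (simp add: f_def)
      also have "\<dots> \<le> of_nat (card ?S) * 1"
        by (rule sum_bounded_above) (auto simp: f_def)
      finally have le: "suminf (\<lambda>n. f n x) \<le> of_nat (card ?S)" by simp
      show ?case
      proof (cases "x \<in> B")
        case True
        have "of_nat (card ?S) \<le> (of_nat (mpoly_degree_in p k) :: ennreal)"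
          using S(2) by (rule of_nat_mono)
        then have "suminf (\<lambda>n. f n x) \<le> of_nat (mpoly_degree_in p k)" by (rule order.trans[OF le])
        then show ?thesis using True by simp
      next
        case False
        have "x \<in> B" if n: "x \<in> shadow k (E n)" for n
        proof -
          obtain t where x: "x $ k \<in> {0..1}" and "x + t *\<^sub>R axis k 1 \<in> E n"
            using n by (auto simp: shadow_def)
          then have t: "(x + t *\<^sub>R axis k 1) $ i \<in> {a..b}" for i using E(2) by blast
          have "x $ i \<in> {a..b}" if "i \<noteq> k" for i
            using t[of i] that by (simp add: axis_def)
          then show ?thesis using x by (auto simp: B_def mem_box_cart)
        qed
        then have "?S = {}" using False by blast
        then show ?thesis using le by simp
      qed
    qed
  qed
  also have "\<dots> = of_nat (mpoly_degree_in p k) * emeasure lborel B"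
    by (rule nn_integral_cmult_indicator) (simp add: B_def)
  also have "\<dots> = ennreal (real (mpoly_degree_in p k) * (b - a) ^ (CARD('n) - 1))"
    unfolding B_def emeasure_slab_box[OF \<open>a < b\<close>] using \<open>a < b\<close>
    by (simp add: ennreal_of_nat_eq_real_of_nat flip: ennreal_mult)
  finally show ?thesis .
qed

section \<open>Assembling the pieces and removing the factor\<close>

lemma power_mult_hausdorff_measure_zero_set_le:
  fixes p :: "'n::finite real_mpoly"
  assumes x: "mpoly_eval p x \<noteq> 0" and "a < b" and c: "0 < c" "c < 1"
  shows "ennreal (c ^ CARD('n)) *
      hausdorff_measure (CARD('n) - 1) (zero_set p \<inter> {x. \<forall>i. x $ i \<in> {a..b}})
    \<le> ennreal (real (\<Sum>k\<in>UNIV. mpoly_degree_in p k) * (b - a) ^ (CARD('n) - 1))"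
proof -
  define A where "A = zero_set p \<inter> {x. \<forall>i. x $ i \<in> {a..b}}"
  obtain W :: "nat \<Rightarrow> (real ^ 'n) set" where
    W: "\<And>n. regular_piece (c ^ CARD('n)) (W n)" and cov: "zero_set p \<subseteq> (\<Union>n. W n)"
    using countable_regular_pieces[OF real_polynomial_function_mpoly_eval x c] unfolding zero_set_def by blast
  have Wnull: "W n \<in> null_sets lborel" for n using W by (simp add: regular_piece_def)
  obtain K where K: "\<And>n E. E \<in> sets borel \<Longrightarrow> E \<subseteq> W n \<Longrightarrow> (\<forall>k\<in>K n. shadow k E \<in> sets borel) \<and>
     ennreal (c ^ CARD('n)) * hausdorff_measure (CARD('n) - 1) E \<le> (\<Sum>k\<in>K n. emeasure lborel (shadow k E))"
    using W unfolding regular_piece_def by metis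
  have "continuous_on UNIV (mpoly_eval p)"
    using real_polynomial_function_mpoly_eval[of p]
    by (intro continuous_on_polymonial_function) (simp add: real_polynomial_function_eq)
  then have cl: "closed (zero_set p)" unfolding zero_set_def by (intro closed_Collect_eq) auto
  have null: "zero_set p \<in> null_sets lborel"
    using null_sets_UN[of W lborel] Wnull cl by (intro null_sets_subset[OF _ _ cov]) auto
  have "{x :: real ^ 'n. \<forall>i. x $ i \<in> {a..b}} = cbox (\<chi> i. a) (\<chi> i. b)"
    by (auto simp: mem_box_cart)
  then have A: "A \<in> sets borel" using cl by (simp add: A_def)
  define E where "E n = A \<inter> disjointed W n" for n
  have Wb: "W n \<in> sets borel" for n using Wnull[of n] by auto
  then have "range W \<subseteq> sets borel" by auto
  then have "range (disjointed W) \<subseteq> sets borel" by (rule sets.range_disjointed_sets)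
  then have Eb: "E n \<in> sets borel" for n using A unfolding E_def by auto
  have Ed: "disjoint_family E"
    using disjoint_family_disjointed[of W] by (auto simp: disjoint_family_on_def E_def)
  have EW: "E n \<subseteq> W n" for n using disjointed_subset[of W n] by (auto simp: E_def)
  have AE: "A = (\<Union>n. E n)" using cov by (auto simp: E_def A_def UN_disjointed_eq simp flip: Int_UN_distrib)
  \<comment> \<open>Padding with zeros outside \<open>K n\<close> makes the range of
    \<open>k\<close> independent of \<open>n\<close>, so that the two sums can be exchanged.\<close>
  define g where "g n k = (if n \<in> {n. k \<in> K n} then emeasure lborel (shadow k (E n)) else 0)" for n k
  have "ennreal (c ^ CARD('n)) * hausdorff_measure (CARD('n) - 1) A
      \<le> ennreal (c ^ CARD('n)) * suminf (\<lambda>n. hausdorff_measure (CARD('n) - 1) (E n))"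
    unfolding AE by (intro mult_left_mono hausdorff_measure_UN_le) simp
  also have "\<dots> = suminf (\<lambda>n. ennreal (c ^ CARD('n)) * hausdorff_measure (CARD('n) - 1) (E n))"
    by (rule ennreal_suminf_cmult[symmetric])
  also have "\<dots> \<le> suminf (\<lambda>n. \<Sum>k\<in>K n. emeasure lborel (shadow k (E n)))"
    using K[OF Eb EW] by (intro suminf_le) auto
  also have "\<dots> = suminf (\<lambda>n. \<Sum>k\<in>UNIV. g n k)"
    by (intro arg_cong[of _ _ suminf] ext sum.mono_neutral_cong_left) (auto simp: g_def)
  also have "\<dots> = (\<Sum>k\<in>UNIV. suminf (\<lambda>n. g n k))"
    by (rule suminf_sum) auto
  also have "\<dots> \<le> (\<Sum>k\<in>UNIV. ennreal (real (mpoly_degree_in p k) * (b - a) ^ (CARD('n) - 1)))"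
    unfolding g_def using K[OF Eb EW]
    by (intro sum_mono suminf_shadows_le[OF null \<open>a < b\<close> Ed]) (auto simp: E_def A_def)
  also have "\<dots> = ennreal (real (\<Sum>k\<in>UNIV. mpoly_degree_in p k) * (b - a) ^ (CARD('n) - 1))"
    using \<open>a < b\<close> by (simp add: sum_distrib_right)
  finally show ?thesis unfolding A_def .
qed

text \<open>Lets \<open>c\<close> increase to 1. Neither \<open>H\<close> nor the bound depends on
  \<open>c\<close>, although the decomposition behind each single inequality does.\<close>

lemma ennreal_le_of_power_mult_le:
  fixes H :: ennreal
  assumes "\<And>c::real. 0 < c \<Longrightarrow> c < 1 \<Longrightarrow> ennreal (c ^ n) * H \<le> ennreal R"
  shows "H \<le> ennreal R"
proof -
  have "ennreal ((1/2) ^ n) * H \<noteq> top"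
    using assms[of "1/2"] by (auto simp: top_unique)
  then have "H \<noteq> top" by (auto simp: ennreal_mult_top)
  have "((\<lambda>c. ennreal (c ^ n) * H) \<longlongrightarrow> ennreal (1 ^ n) * H) (at_left 1)"
    using \<open>H \<noteq> top\<close> by (intro tendsto_mult_ennreal tendsto_ennrealI tendsto_intros) auto
  moreover have "\<forall>\<^sub>F c in at_left 1. ennreal (c ^ n) * H \<le> ennreal R"
    by (rule eventually_at_leftI[of 0]) (auto intro: assms)
  ultimately have "ennreal (1 ^ n) * H \<le> ennreal R"
    by (rule tendsto_upperbound) simp
  then show ?thesis by simp
qed

theorem mainTheorem1:
  fixes p :: "'n::finite real_mpoly" and a b :: real
  assumes "\<exists>x. mpoly_eval p x \<noteq> 0"
    and "a < b"
  shows "hausdorff_measure (CARD('n) - 1) (zero_set p \<inter> {x. \<forall>i. x $ i \<in> {a..b}})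
      \<le> ennreal (real (\<Sum>k\<in>UNIV. mpoly_degree_in p k) * (b - a) ^ (CARD('n) - 1))"
  using assms by (blast intro: ennreal_le_of_power_mult_le power_mult_hausdorff_measure_zero_set_le)

end
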